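(* For every integer $n\ge 3$, $\mathrm{Aut}(A_n(\mathbf{R}))$ contains a subgroup $\widehat F$ isomorphic to Thompson's group $F\simeq F_2\simeq F_{2,\infty}$, and the intersection of $\widehat F$ with $\mathrm{Aut}_{PL}(A_n(\mathbf{R}))$ is trivial.
   Context: Functions are written to the right of their arguments and composed from left to right. For an integer $n\ge 2$: $\mathbf{Z}[\frac1n]=\{an^b : a,b\in\mathbf{Z}\}$ and $\langle n\rangle=\{n^k : k\in\mathbf{Z}\}$. A break of a piecewise linear (PL) function is a point where its derivative is discontinuous. $A_n(\mathbf{R})$ is the group of all homeomorphisms $h:\mathbf{R}\to\mathbf{R}$ such that (1) $h$ preserves orientation, (2) $h$ is PL, (3) all slopes of $h$ are in $\langle n\rangle$, (4) the breaks of $h$ lie in a discrete subset of $\mathbf{Z}[\frac1n]$, (5) $(\mathbf{Z}[\frac1n])h=\mathbf{Z}[\frac1n]$. Every automorphism of $A_n(\mathbf{R})$ is conjugation $f\mapsto h^{-1}fh$ by a unique self homeomorphism $h$ of $\mathbf{R}$, so $\mathrm{Aut}(A_n(\mathbf{R}))$ is identified with the normalizer of $A_n(\mathbf{R})$ in $\mathrm{Homeo}(\mathbf{R})$. $\mathrm{Aut}_{PL}(A_n(\mathbf{R}))$ is the subgroup of those automorphisms for which $h$ is PL. The group $F=F_2=F_{2,\infty}$ is the subgroup of $A_2(\mathbf{R})$ generated by the translation $xt_1=x+1$ and the homeomorphisms $g_i$, $i\in\mathbf{Z}$, where $xg_i=x$ for $x<i$, $xg_i=2(x-i)+i$ for $i\le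 x\le i+1$, and $xg_i=x+1$ for $x>i+1$ (it is isomorphic to Thompson's group $F$). *)

theory Defs
  imports "HOL-Analysis.Analysis" "HOL-Algebra.Bij" "HOL-Algebra.Generated_Groups"
begin

definition Z_inv :: "int \<Rightarrow> real set" where
  "Z_inv n = {of_int a * of_int n powi b | a b :: int. True}"

definition powers_of :: "int \<Rightarrow> real set" where
  "powers_of n = range (\<lambda>k :: int. of_int n powi k)"

definition homeo_R :: "(real \<Rightarrow> real) \<Rightarrow> bool" where
  "homeo_R h \<longleftrightarrow> (\<exists>g. homeomorphism UNIV UNIV h g)"

text \<open>Off a set \<open>B\<close> without accumulation points in the line, the function is affine on every
  interval; equivalently, every compact interval splits into finitely many affine pieces.\<close>

definition piecewise_linear :: "(real \<Rightarrow> real) \<Rightarrow> bool" where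
  "piecewise_linear f \<longleftrightarrow> continuous_on UNIV f \<and>
     (\<exists>B. (\<forall>x. \<not> x islimpt B) \<and>
        (\<forall>a b. {a<..<b} \<inter> B = {} \<longrightarrow> (\<exists>m c. \<forall>x\<in>{a<..<b}. f x = m * x + c)))"

text \<open>A point is not a break if the derivative exists near it and is continuous there. The
  first conjunct is needed because \<^const>\<open>deriv\<close> is total and takes an unspecified value where
  the function is not differentiable.\<close>

definition breaks :: "(real \<Rightarrow> real) \<Rightarrow> real set" where
  "breaks f = {x. \<not> ((\<forall>\<^sub>F y in nhds x. f differentiable at y) \<and> isCont (deriv f) x)}"

definition slopes :: "(real \<Rightarrow> real) \<Rightarrow> real set" where
  "slopes f = {D. \<exists>x. (f has_real_derivative D) (at x)}"

text \<open>Functions act on the right, so the product of \<open>f\<close> and \<open>g\<close> is ``first \<open>f\<close>, then \<open>g\<close>''.\<close>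

definition A_group :: "int \<Rightarrow> (real \<Rightarrow> real) monoid" where
  "A_group n =
     \<lparr>carrier = {h. homeo_R h \<and> strict_mono h \<and> piecewise_linear h \<and> slopes h \<subseteq> powers_of n \<and>
                    (\<exists>D \<subseteq> Z_inv n. discrete D \<and> breaks h \<subseteq> D) \<and> h ` Z_inv n = Z_inv n},
      mult = (\<lambda>f g. g \<circ> f),
      one = id\<rparr>"

text \<open>With right actions, \<open>h\<^sup>-\<^sup>1 f h\<close> sends \<open>x\<close> to \<open>h (f (inv_into UNIV h x))\<close>. The homeomorphism inducing a
  given automorphism is unique, so ``the'' inducing homeomorphism is PL iff some inducing one is.
  The library's \<^const>\<open>AutoGroup\<close> composes automorphisms from right to left; this is the opposite
  group of the left-to-right one, with the same subgroups and isomorphic to it by inversion.\<close>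

definition conj_by :: "int \<Rightarrow> (real \<Rightarrow> real) \<Rightarrow> (real \<Rightarrow> real) \<Rightarrow> (real \<Rightarrow> real)" where
  "conj_by n h = (\<lambda>f \<in> carrier (A_group n). h \<circ> f \<circ> inv_into UNIV h)"

definition Aut_PL :: "int \<Rightarrow> ((real \<Rightarrow> real) \<Rightarrow> (real \<Rightarrow> real)) set" where
  "Aut_PL n = {\<phi> \<in> carrier (AutoGroup (A_group n)).
     \<exists>h. homeo_R h \<and> piecewise_linear h \<and> \<phi> = conj_by n h}"

definition t1 :: "real \<Rightarrow> real" where
  "t1 x = x + 1"

definition g_gen :: "int \<Rightarrow> real \<Rightarrow> real" where
  "g_gen i x = (if x < of_int i then x
                else if x \<le> of_int i + 1 then 2 * (x - of_int i) + of_int i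
                else x + 1)"

definition Thompson_F :: "(real \<Rightarrow> real) monoid" where
  "Thompson_F = subgroup_generated (A_group 2) ({t1} \<union> range g_gen)"

end

theory Submission
  imports Defs
begin

text \<open>
  The elements of \<open>A\<^sub>n\<close> are the increasing homeomorphisms of the line that agree, on each side of every
  point, with a map \<open>x \<mapsto> n\<^sup>k x + c\<close> where \<open>c\<close> is in \<open>\<int>[1/n]\<close>, and with the same map on both sides of
  a point outside \<open>\<int>[1/n]\<close> (\<open>carrier_A_group\<close>). An increasing homeomorphism \<open>h\<close> therefore conjugates \<open>A\<^sub>n\<close> into
  itself as soon as it maps \<open>\<int>[1/n]\<close> to itself and conjugates these affine maps into \<open>A\<^sub>n\<close>; they are
  generated by multiplication by \<open>n\<close> and the unit translation.

  Such \<open>h\<close> arise as conjugacies between expanding maps. Let \<open>\<phi>\<close> be a homeomorphism of the line supported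
  in the unit interval, and let \<open>\<kappa>\<close> act as a translated copy of \<open>\<phi>\<close> on \<open>[k, k + 1]\<close> if \<open>k \<equiv> 1\<close> modulo \<open>n\<close>,
  and trivially on the other unit intervals. The map \<open>E x = \<kappa> (n x)\<close> is increasing and satisfies
  \<open>E (x + 1) = E x + n\<close>, so \<open>h x = lim E\<^sup>k x / n\<^sup>k\<close> exists, commutes with the unit translation, and is the
  only map at bounded distance from the identity with \<open>h \<circ> E = n h\<close>.

  The map \<open>\<kappa>\<close> alters an n-adic interval only below a digit \<open>1\<close>. Because \<open>n \<ge> 3\<close>, the digit \<open>1\<close> differs
  from the two end digits \<open>0\<close> and \<open>n - 1\<close>. Hence every \<open>h\<close> looks the same, up to scale, on all
  subintervals of \<open>[0, 1]\<close> that are reached through end digits only, and it commutes with a homeomorphism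
  that permutes such subintervals affinely. Subdividing only along end digits is a binary subdivision
  (the middle part is carried along), so there is a copy of Thompson's group \<open>F\<close> on \<open>[0, 1]\<close> of
  this kind, generated by \<open>shift\<close> and \<open>double\<close>. For \<open>\<phi>\<close> in this copy, commutation turns \<open>h \<circ> \<kappa> \<circ> n = n h\<close>
  into \<open>\<kappa> \<circ> h \<circ> n = n h\<close>. This gives two things: \<open>h\<close> conjugates multiplication by \<open>n\<close> to an element of
  \<open>A\<^sub>n\<close>, so \<open>h\<close> normalizes \<open>A\<^sub>n\<close> (\<open>conjugator_normalizes\<close>); and \<open>\<phi> \<mapsto> h\<close> is a homomorphism
  (\<open>conjugator_compose\<close>).

  That \<open>shift\<close> and \<open>double\<close> generate a copy of \<open>F\<close> is seen from an increasing map \<open>cantor\<close> from the line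
  to \<open>(0, 1)\<close>, given by the n-ary expansions with digits \<open>0\<close> and \<open>n - 1\<close> whose pattern is read off binary
  expansions. It intertwines \<open>t\<^sub>1\<close> with \<open>shift\<close> and \<open>g\<^sub>0\<close> with \<open>double\<close>. An element of \<open>F\<close> and
  its copy determine each other because \<open>cantor\<close> is injective, and because elements of the copy are
  affine on the gaps of its image (\<open>inflates_unique\<close>, \<open>inflates_injective\<close>).

  Finally, \<open>h (n x) = n h x\<close> for \<open>0 \<le> x \<le> 1/n\<close>. If \<open>h\<close> is PL, it is linear near \<open>0\<close>, hence on \<open>[0, 1]\<close>, and
  \<open>h 1 = 1\<close> forces \<open>h = id\<close> (\<open>piecewise_linear_conjugator\<close>). An automorphism determines the map that
  induces it (\<open>conj_by_inject\<close>), since every point of \<open>\<int>[1/n]\<close> is the boundary of the fixed-point set of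
  an element of \<open>A\<^sub>n\<close>; so the homomorphism to the automorphism group is injective and no nontrivial
  element of its image is PL.\<close>

section \<open>Piecewise affine homeomorphisms with n-adic breaks\<close>

abbreviation finv :: "('a \<Rightarrow> 'b) \<Rightarrow> 'b \<Rightarrow> 'a" where "finv f \<equiv> inv_into UNIV f"

lemma strict_mono_surj_homeo:
  fixes f :: "real \<Rightarrow> real"
  assumes "strict_mono f" "surj f"
  shows strict_mono_surj_bij: "bij f"
    and strict_mono_surj_inv: "strict_mono (finv f)" "surj (finv f)"
    and strict_mono_surj_continuous: "continuous_on UNIV f"
    and strict_mono_surj_homeo_R: "homeo_R f"
proof -
  show bij: "bij f" using assms by (simp add: bij_def strict_mono_imp_inj_on)
  show inv: "strict_mono (finv f)"
    using assms by (metis strict_mono_inv strict_mono_imp_inj_on inv_f_f)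
  show si: "surj (finv f)" using bij by (simp add: bij_imp_bij_inv bij_is_surj)
  have cont: "continuous_on UNIV g" if "strict_mono g" "surj g" for g :: "real \<Rightarrow> real"
    using that by (intro continuous_onI_mono) (auto simp: strict_mono_less_eq)
  show "continuous_on UNIV f" using cont assms by blast
  show "homeo_R f"
    unfolding homeo_R_def using cont[OF assms] cont[OF inv si] assms(2) si bij
    by (intro exI[of _ "finv f"] homeomorphismI) (auto simp: bij_inv_eq_iff inv_f_f bij_is_inj surj_f_inv_f)
qed

lemma strict_mono_surj_isCont:
  fixes f :: "real \<Rightarrow> real"
  assumes "strict_mono f" "surj f"
  shows "isCont f x"
  using strict_mono_surj_continuous[OF assms] by (simp add: continuous_on_eq_continuous_at)

lemma strict_mono_surj_filterlim:
  fixes f :: "real \<Rightarrow> real"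
  assumes "strict_mono f" "surj f"
  shows strict_mono_surj_at_right: "filterlim f (at_right (f y)) (at_right y)"
    and strict_mono_surj_at_left: "filterlim f (at_left (f y)) (at_left y)"
proof -
  have *: "(f \<longlongrightarrow> f y) (at y within S)" for S
    using strict_mono_surj_isCont[OF assms, of y] unfolding isCont_def
    by (rule tendsto_within_subset) auto
  show "filterlim f (at_right (f y)) (at_right y)" "filterlim f (at_left (f y)) (at_left y)"
    using assms(1) *
    by (auto simp: filterlim_at eventually_at_filter strict_mono_less strict_mono_eq intro!: always_eventually)
qed

lemma strict_mono_surj_compose:
  fixes f g :: "real \<Rightarrow> real"
  assumes "strict_mono f" "surj f" "strict_mono g" "surj g"
  shows "strict_mono (f \<circ> g)" "surj (f \<circ> g)"
  using assms comp_surj[of g f] by (auto simp: strict_mono_def)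

locale n_adic =
  fixes n :: int
  assumes n_ge_2: "2 \<le> n"
begin

abbreviation N :: real where "N \<equiv> of_int n"

abbreviation Z :: "real set" where "Z \<equiv> Z_inv n"

lemma N_ge_2: "2 \<le> N"
  using n_ge_2 by simp

lemma n_pos [simp]: "0 < n" "n \<noteq> 0" "0 \<le> n" "\<not> n < 0" "0 < N" "N \<noteq> 0"
  using n_ge_2 by auto

lemma N_power_pos [simp]: "0 < N ^ k" "0 \<le> N ^ k" "\<bar>N ^ k\<bar> = N ^ k"
  using zero_less_power[OF n_pos(5), of k] by linarith+

lemma Z_cases:
  assumes "x \<in> Z" obtains a b :: int where "x = of_int a * N powi b"
  using assms by (auto simp: Z_inv_def)

lemma Z_of_int [simp]: "of_int a \<in> Z"
  unfolding Z_inv_def by (rule CollectI, rule exI[of _ a], rule exI[of _ 0]) simp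

lemma Z_numeral [simp]: "numeral k \<in> Z"
  using Z_of_int[of "numeral k"] by simp

lemma Z_0_1 [simp]: "0 \<in> Z" "1 \<in> Z"
  using Z_of_int[of 0] Z_of_int[of 1] by simp_all

lemma Z_mult: "x \<in> Z \<Longrightarrow> y \<in> Z \<Longrightarrow> x * y \<in> Z"
proof (elim Z_cases)
  fix a b c d assume "x = of_int a * N powi b" "y = of_int c * N powi d"
  then have "x * y = of_int (a * c) * N powi (b + d)"
    by (simp add: power_int_add)
  then show ?thesis unfolding Z_inv_def by blast
qed

lemma Z_powi [simp]: "N powi k \<in> Z"
  unfolding Z_inv_def by (rule CollectI, rule exI[of _ 1], rule exI[of _ k]) simp

lemma Z_uminus: "x \<in> Z \<Longrightarrow> - x \<in> Z"
  using Z_mult[of "-1" x] Z_of_int[of "-1"] by simp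

lemma Z_add: "x \<in> Z \<Longrightarrow> y \<in> Z \<Longrightarrow> x + y \<in> Z"
proof (elim Z_cases)
  fix a b c d assume xy: "x = of_int a * N powi b" "y = of_int c * N powi d"
  define m where "m = min b d"
  have *: "N powi e = of_int (n ^ nat (e - m)) * N powi m" if "m \<le> e" for e
  proof -
    have "N powi e = N powi (e - m) * N powi m"
      using power_int_add[of N "e - m" m] by simp
    then show ?thesis using that by (simp add: power_int_def)
  qed
  have "x + y = of_int (a * n ^ nat (b - m) + c * n ^ nat (d - m)) * N powi m"
    using xy *[of b] *[of d] by (simp add: m_def algebra_simps)
  then show ?thesis unfolding Z_inv_def by blast
qed

lemma Z_diff: "x \<in> Z \<Longrightarrow> y \<in> Z \<Longrightarrow> x - y \<in> Z"
  using Z_add[of x "- y"] Z_uminus[of y] by simp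

lemma Z_inverse_N [simp]: "1 / N \<in> Z"
  using Z_powi[of "-1"] by (simp add: field_simps)

lemma Z_powi_mult_iff: "N powi k * x \<in> Z \<longleftrightarrow> x \<in> Z"
proof
  assume "N powi k * x \<in> Z"
  from Z_mult[OF Z_powi[of "-k"] this] show "x \<in> Z"
    by (simp add: power_int_minus field_simps)
qed (simp add: Z_mult)

lemma Z_dense:
  assumes "x < y" obtains z where "z \<in> Z" "x < z" "z < y"
proof -
  obtain k :: nat where k: "1 / (y - x) < N ^ k"
    using real_arch_pow[of N "1 / (y - x)"] N_ge_2 by auto
  define z where "z = of_int (\<lfloor>x * N ^ k\<rfloor> + 1) * N powi (- int k)"
  have z: "z = of_int (\<lfloor>x * N ^ k\<rfloor> + 1) / N ^ k"
    by (simp add: z_def power_int_minus power_int_of_nat divide_inverse)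
  have Nk: "0 < N ^ k" by simp
  have "1 < (y - x) * N ^ k" using k assms by (simp add: field_simps)
  then have "x * N ^ k < of_int (\<lfloor>x * N ^ k\<rfloor> + 1)" "of_int (\<lfloor>x * N ^ k\<rfloor> + 1) < y * N ^ k"
    by (linarith, simp add: algebra_simps) linarith
  then have "x < z" "z < y" using Nk by (auto simp: z pos_less_divide_eq pos_divide_less_eq)
  moreover have "z \<in> Z" unfolding z_def by (intro Z_mult Z_of_int Z_powi)
  ultimately show ?thesis using that by blast
qed

definition aff :: "(real \<Rightarrow> real) set" where
  "aff = {\<lambda>x. N powi k * x + c | (k :: int) c. c \<in> Z}"

lemma affI: "c \<in> Z \<Longrightarrow> (\<lambda>x. N powi k * x + c) \<in> aff"
  unfolding aff_def by blast

lemma affE: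
  assumes "\<alpha> \<in> aff" obtains k :: int and c where "\<alpha> = (\<lambda>x. N powi k * x + c)" "c \<in> Z"
  using assms unfolding aff_def by blast

lemma aff_translation: "c \<in> Z \<Longrightarrow> (\<lambda>x. x + c) \<in> aff"
  using affI[of c 0] by simp

lemma aff_id: "id \<in> aff"
  using aff_translation[of 0] by (simp add: id_def)

lemma aff_compose: "\<alpha> \<in> aff \<Longrightarrow> \<beta> \<in> aff \<Longrightarrow> \<alpha> \<circ> \<beta> \<in> aff"
proof (elim affE)
  fix k c l d
  assume *: "\<alpha> = (\<lambda>x. N powi k * x + c)" "c \<in> Z" "\<beta> = (\<lambda>x. N powi l * x + d)" "d \<in> Z"
  then have "\<alpha> \<circ> \<beta> = (\<lambda>x. N powi (k + l) * x + (N powi k * d + c))"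
    by (auto simp: fun_eq_iff power_int_add algebra_simps)
  then show ?thesis using * by (simp add: affI Z_add Z_mult)
qed

lemma aff_inverse:
  assumes "\<alpha> \<in> aff" obtains \<beta> where "\<beta> \<in> aff" "\<And>x. \<alpha> (\<beta> x) = x" "\<And>x. \<beta> (\<alpha> x) = x"
proof -
  obtain k c where *: "\<alpha> = (\<lambda>x. N powi k * x + c)" "c \<in> Z" using assms by (rule affE)
  have "(\<lambda>x. N powi (- k) * x + - (N powi (-k) * c)) \<in> aff"
    using * by (intro affI Z_uminus Z_mult) auto
  then show ?thesis by (rule that) (auto simp: * power_int_minus field_simps)
qed

lemma aff_strict_mono: "\<alpha> \<in> aff \<Longrightarrow> strict_mono \<alpha>"
  by (elim affE) (auto simp: strict_mono_def)

lemma aff_surj: "\<alpha> \<in> aff \<Longrightarrow> surj \<alpha>"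
  by (erule aff_inverse) (metis surjI)

lemma aff_Z_iff: "\<alpha> \<in> aff \<Longrightarrow> \<alpha> x \<in> Z \<longleftrightarrow> x \<in> Z"
  by (elim affE) (metis Z_add Z_diff Z_powi_mult_iff add_diff_cancel_right')

lemma aff_eqI:
  assumes "\<alpha> \<in> aff" "\<beta> \<in> aff" "\<alpha> x = \<beta> x" "\<alpha> y = \<beta> y" "x \<noteq> y"
  shows "\<alpha> = \<beta>"
proof -
  obtain k c l d where *: "\<alpha> = (\<lambda>x. N powi k * x + c)" "\<beta> = (\<lambda>x. N powi l * x + d)"
    using assms by (metis affE)
  have "(N powi k - N powi l) * (x - y) = 0" using assms(3,4) unfolding * by (simp add: algebra_simps)
  then have "N powi k = N powi l" using assms(5) by simp
  moreover from this have "c = d" using assms(3) unfolding * by simp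
  ultimately show ?thesis unfolding * by simp
qed

lemma aff_eq_eventually:
  assumes "\<alpha> \<in> aff" "\<beta> \<in> aff" "\<forall>\<^sub>F z in at_right y. \<alpha> z = \<beta> z"
  shows "\<alpha> = \<beta>"
proof -
  obtain b where b: "b > y" "\<And>z. y < z \<Longrightarrow> z < b \<Longrightarrow> \<alpha> z = \<beta> z"
    using assms(3) unfolding eventually_at_right_field by blast
  obtain u where u: "y < u" "u < b" using dense b(1) by blast
  obtain v where v: "u < v" "v < b" using dense u(2) by blast
  show ?thesis using aff_eqI[OF assms(1,2), of u v] b(2)[of u] b(2)[of v] u v by simp
qed

text \<open>One-sided affine germs, \<open>\<alpha>\<close> on the left and \<open>\<beta>\<close> on the right. Describing elements of \<open>A\<^sub>n\<close> by germs
  makes compositions, inverses and gluing local computations, with no bookkeeping of breaks.\<close>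

definition germ :: "(real \<Rightarrow> real) \<Rightarrow> real \<Rightarrow> (real \<Rightarrow> real) \<Rightarrow> (real \<Rightarrow> real) \<Rightarrow> bool" where
  "germ f y \<alpha> \<beta> \<longleftrightarrow> (\<forall>\<^sub>F z in at_left y. f z = \<alpha> z) \<and> (\<forall>\<^sub>F z in at_right y. f z = \<beta> z)
     \<and> (y \<notin> Z \<longrightarrow> \<alpha> = \<beta>)"

definition PL :: "(real \<Rightarrow> real) set" where
  "PL = {f. strict_mono f \<and> surj f \<and> (\<forall>y. \<exists>\<alpha>\<in>aff. \<exists>\<beta>\<in>aff. germ f y \<alpha> \<beta>)}"

lemma PL_strict_mono: "f \<in> PL \<Longrightarrow> strict_mono f"
  and PL_surj: "f \<in> PL \<Longrightarrow> surj f"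
  by (auto simp: PL_def)

lemma PL_bij: "f \<in> PL \<Longrightarrow> bij f"
  using strict_mono_surj_bij PL_strict_mono PL_surj by blast

lemma PL_germE:
  assumes "f \<in> PL" obtains \<alpha> \<beta> where "\<alpha> \<in> aff" "\<beta> \<in> aff" "germ f y \<alpha> \<beta>"
  using assms unfolding PL_def by blast

lemma aff_subset_PL: "\<alpha> \<in> aff \<Longrightarrow> \<alpha> \<in> PL"
  unfolding PL_def germ_def using aff_strict_mono aff_surj by force

lemma PL_id: "id \<in> PL" using aff_subset_PL aff_id by blast

text \<open>Being in \<^term>\<open>PL\<close> is a local property: it may be tested against members of \<^term>\<open>PL\<close> that
  vary with the point. This is how all elements of \<open>A\<^sub>n\<close> below are recognized.\<close>

lemma PL_glue:
  assumes "strict_mono f" "surj f"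
    and loc: "\<And>y. \<exists>\<alpha>\<in>PL. \<exists>\<beta>\<in>PL. germ f y \<alpha> \<beta>"
  shows "f \<in> PL"
  unfolding PL_def
proof (intro CollectI conjI allI assms(1,2))
  fix y
  obtain \<alpha> \<beta> where *: "\<alpha> \<in> PL" "\<beta> \<in> PL" "germ f y \<alpha> \<beta>" using loc by blast
  obtain \<alpha>1 \<alpha>2 where a: "\<alpha>1 \<in> aff" "\<alpha>2 \<in> aff" "germ \<alpha> y \<alpha>1 \<alpha>2" using *(1) by (rule PL_germE)
  obtain \<beta>1 \<beta>2 where b: "\<beta>1 \<in> aff" "\<beta>2 \<in> aff" "germ \<beta> y \<beta>1 \<beta>2" using *(2) by (rule PL_germE)
  show "\<exists>\<alpha>\<in>aff. \<exists>\<beta>\<in>aff. germ f y \<alpha> \<beta>"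
  proof (cases "y \<in> Z")
    case True
    then have "germ f y \<alpha>1 \<beta>2" using *(3) a(3) b(3) unfolding germ_def
      by (auto elim: eventually_elim2)
    then show ?thesis using a b by blast
  next
    case False
    then have "germ f y \<alpha>1 \<alpha>2" using *(3) a(3) unfolding germ_def
      by (auto elim: eventually_elim2)
    then show ?thesis using a by blast
  qed
qed

lemma germ_value:
  assumes "f \<in> PL" "\<alpha> \<in> aff" "\<beta> \<in> aff" "germ f y \<alpha> \<beta>"
  shows "f y = \<alpha> y" "f y = \<beta> y"
proof -
  have cont: "(g \<longlongrightarrow> g y) (at y within S)" if "g \<in> PL" for g S
    using strict_mono_surj_isCont[OF PL_strict_mono[OF that] PL_surj[OF that], of y]
    unfolding isCont_def by (rule tendsto_within_subset) auto
  have l: "\<forall>\<^sub>F z in at_left y. f z = \<alpha> z" and r: "\<forall>\<^sub>F z in at_right y. f z = \<beta> z"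
    using assms(4) by (simp_all add: germ_def)
  show "f y = \<alpha> y"
    by (rule tendsto_unique[OF trivial_limit_at_left_real _ cont[OF aff_subset_PL[OF assms(2)]]])
      (rule tendsto_cong[THEN iffD1, OF l cont[OF assms(1)]])
  show "f y = \<beta> y"
    by (rule tendsto_unique[OF trivial_limit_at_right_real _ cont[OF aff_subset_PL[OF assms(3)]]])
      (rule tendsto_cong[THEN iffD1, OF r cont[OF assms(1)]])
qed

lemma PL_Z_iff:
  assumes "f \<in> PL" shows "f y \<in> Z \<longleftrightarrow> y \<in> Z"
proof -
  obtain \<alpha> \<beta> where *: "\<alpha> \<in> aff" "\<beta> \<in> aff" "germ f y \<alpha> \<beta>" using assms by (rule PL_germE)
  then show ?thesis using germ_value(1)[OF assms *] aff_Z_iff by simp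
qed

lemma PL_compose:
  assumes "f \<in> PL" "g \<in> PL" shows "f \<circ> g \<in> PL"
  unfolding PL_def
proof (intro CollectI conjI allI)
  show "strict_mono (f \<circ> g)" "surj (f \<circ> g)"
    using strict_mono_surj_compose[of f g] assms[THEN PL_strict_mono] assms[THEN PL_surj] by simp_all
  fix y
  obtain \<alpha>1 \<alpha>2 where a: "\<alpha>1 \<in> aff" "\<alpha>2 \<in> aff" "germ f (g y) \<alpha>1 \<alpha>2" using assms(1) by (rule PL_germE)
  obtain \<beta>1 \<beta>2 where b: "\<beta>1 \<in> aff" "\<beta>2 \<in> aff" "germ g y \<beta>1 \<beta>2" using assms(2) by (rule PL_germE)
  have "\<forall>\<^sub>F z in at_left y. f (g z) = \<alpha>1 (g z)"
    using a(3) strict_mono_surj_at_left[OF PL_strict_mono[OF assms(2)] PL_surj[OF assms(2)], of y]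
    unfolding germ_def filterlim_iff by blast
  moreover have "\<forall>\<^sub>F z in at_right y. f (g z) = \<alpha>2 (g z)"
    using a(3) strict_mono_surj_at_right[OF PL_strict_mono[OF assms(2)] PL_surj[OF assms(2)], of y]
    unfolding germ_def filterlim_iff by blast
  ultimately have "germ (f \<circ> g) y (\<alpha>1 \<circ> \<beta>1) (\<alpha>2 \<circ> \<beta>2)"
    using a(3) b(3) PL_Z_iff[OF assms(2), of y] unfolding germ_def
    by (auto elim: eventually_elim2)
  then show "\<exists>\<alpha>\<in>aff. \<exists>\<beta>\<in>aff. germ (f \<circ> g) y \<alpha> \<beta>"
    using a b aff_compose by blast
qed

lemma PL_inverse:
  assumes "f \<in> PL" shows "finv f \<in> PL"
  unfolding PL_def
proof (intro CollectI conjI allI)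
  note f = PL_strict_mono[OF assms] PL_surj[OF assms]
  note bij = PL_bij[OF assms]
  show i: "strict_mono (finv f)" "surj (finv f)"
    using strict_mono_surj_inv[OF f] by auto
  fix y
  obtain \<alpha>1 \<alpha>2 where a: "\<alpha>1 \<in> aff" "\<alpha>2 \<in> aff" "germ f (finv f y) \<alpha>1 \<alpha>2"
    using assms(1) by (rule PL_germE)
  obtain \<beta>1 where b1: "\<beta>1 \<in> aff" "\<And>x. \<beta>1 (\<alpha>1 x) = x" "\<And>x. \<alpha>1 (\<beta>1 x) = x" using a(1) by (metis aff_inverse)
  obtain \<beta>2 where b2: "\<beta>2 \<in> aff" "\<And>x. \<beta>2 (\<alpha>2 x) = x" "\<And>x. \<alpha>2 (\<beta>2 x) = x" using a(2) by (metis aff_inverse)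
  have "\<forall>\<^sub>F z in at_left y. f (finv f z) = \<alpha>1 (finv f z)"
    using a(3) strict_mono_surj_at_left[OF i, of y] unfolding germ_def filterlim_iff by blast
  then have 1: "\<forall>\<^sub>F z in at_left y. finv f z = \<beta>1 z"
    by eventually_elim (metis b1(2) bij bij_inv_eq_iff)
  have "\<forall>\<^sub>F z in at_right y. f (finv f z) = \<alpha>2 (finv f z)"
    using a(3) strict_mono_surj_at_right[OF i, of y] unfolding germ_def filterlim_iff by blast
  then have 2: "\<forall>\<^sub>F z in at_right y. finv f z = \<beta>2 z"
    by eventually_elim (metis b2(2) bij bij_inv_eq_iff)
  have 3: "y \<notin> Z \<longrightarrow> \<beta>1 = \<beta>2"
    using a(3) PL_Z_iff[OF assms, of "finv f y"] b1 b2 surj_f_inv_f[OF f(2), of y]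
    unfolding germ_def by (metis ext)
  show "\<exists>\<alpha>\<in>aff. \<exists>\<beta>\<in>aff. germ (finv f) y \<alpha> \<beta>"
    using 1 2 3 b1(1) b2(1) unfolding germ_def by blast
qed

text \<open>Explicit elements with finitely many breaks are obtained by iterating this.\<close>

lemma PL_glue_at:
  assumes "f \<in> PL" "g \<in> PL" "p \<in> Z" "f p = g p"
  shows "(\<lambda>x. if x \<le> p then f x else g x) \<in> PL" (is "?h \<in> PL")
proof (rule PL_glue)
  note mono = PL_strict_mono[OF assms(1)] PL_strict_mono[OF assms(2)]
  note surj = PL_surj[OF assms(1)] PL_surj[OF assms(2)]
  show "strict_mono ?h"
  proof (rule strict_monoI)
    fix x y :: real assume "x < y"
    consider "y \<le> p" | "x \<le> p" "p < y" | "p < x" by linarith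
    then show "?h x < ?h y"
    proof cases
      case 2
      have "f x \<le> f p" "g p < g y" using 2 mono by (auto simp: strict_mono_less_eq strict_mono_less)
      then show ?thesis using 2 assms(4) by auto
    qed (use \<open>x < y\<close> mono in \<open>auto simp: strict_mono_less\<close>)
  qed
  show "surj ?h"
    unfolding surj_def
  proof
    fix y
    show "\<exists>x. y = ?h x"
    proof (cases "y \<le> f p")
      case True
      obtain x where x: "f x = y" using surj(1) by (metis surjD)
      then have "x \<le> p" using True mono(1) strict_mono_less_eq by blast
      then show ?thesis using x by (intro exI[of _ x]) simp
    next
      case False
      obtain x where x: "g x = y" using surj(2) by (metis surjD)
      then have "p < x" using False mono(2) assms(4) by (metis not_le strict_mono_less_eq)
      then show ?thesis using x by (intro exI[of _ x]) simp
    qed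
  qed
  fix y
  consider "y < p" | "y = p" | "p < y" by linarith
  then show "\<exists>\<alpha>\<in>PL. \<exists>\<beta>\<in>PL. germ ?h y \<alpha> \<beta>"
  proof cases
    case 1
    then have "\<forall>\<^sub>F z in nhds y. z < p" by (rule eventually_nhds_in_open[of "{..<p}", simplified])
    then have "germ ?h y f f" unfolding germ_def by (auto simp: eventually_at_filter elim: eventually_mono)
    then show ?thesis using assms by blast
  next
    case 2
    then have "germ ?h y f g" unfolding germ_def using assms(3) by (auto simp: eventually_at_filter)
    then show ?thesis using assms by blast
  next
    case 3
    then have "\<forall>\<^sub>F z in nhds y. p < z" by (rule eventually_nhds_in_open[of "{p<..}", simplified])
    then have "germ ?h y g g" unfolding germ_def by (auto simp: eventually_at_filter elim: eventually_mono)
    then show ?thesis using assms by blast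
  qed
qed

section \<open>The group A_n as a group of local affine maps\<close>

lemma aff_derivative:
  assumes "\<alpha> = (\<lambda>x. N powi k * x + c)" "\<forall>\<^sub>F z in nhds x. f z = \<alpha> z"
  shows "(f has_real_derivative N powi k) (at x)"
proof -
  have "(\<alpha> has_real_derivative N powi k) (at x)"
    unfolding assms(1) by (auto intro!: derivative_eq_intros)
  then show ?thesis using DERIV_cong_ev[OF refl assms(2) refl] by blast
qed

definition nonaffine_points :: "(real \<Rightarrow> real) \<Rightarrow> real set" where
  "nonaffine_points f = {y. \<not> (\<exists>\<alpha>\<in>aff. \<forall>\<^sub>F z in nhds y. f z = \<alpha> z)}"

text \<open>The germs at a point describe the map on a punctured neighbourhood, where it is affine.\<close>

lemma nonaffine_points_no_limit:
  assumes "f \<in> PL" shows "\<not> y islimpt nonaffine_points f"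
proof -
  obtain \<alpha> \<beta> where *: "\<alpha> \<in> aff" "\<beta> \<in> aff" "germ f y \<alpha> \<beta>" using assms by (rule PL_germE)
  have near: "\<exists>\<alpha>\<in>aff. \<forall>\<^sub>F w in nhds z. f w = \<alpha> w"
    if "\<gamma> \<in> aff" "\<And>w. a < w \<Longrightarrow> w < b \<Longrightarrow> f w = \<gamma> w" "a < z" "z < b" for \<gamma> a b z
    using that eventually_nhds_in_open[of "{a<..<b}" z]
    by (intro bexI[of _ \<gamma>]) (auto elim: eventually_mono)
  obtain b where b: "b > y" "\<And>z. y < z \<Longrightarrow> z < b \<Longrightarrow> f z = \<beta> z"
    using *(3) unfolding germ_def eventually_at_right_field by blast
  obtain a where a: "a < y" "\<And>z. a < z \<Longrightarrow> z < y \<Longrightarrow> f z = \<alpha> z"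
    using *(3) unfolding germ_def eventually_at_left_field by blast
  have "\<forall>\<^sub>F z in at_right y. z \<notin> nonaffine_points f"
    unfolding eventually_at_right_field nonaffine_points_def using near[OF *(2) b(2)] b(1) by auto
  moreover have "\<forall>\<^sub>F z in at_left y. z \<notin> nonaffine_points f"
    unfolding eventually_at_left_field nonaffine_points_def using near[OF *(1) a(2)] a(1) by auto
  ultimately show ?thesis by (simp add: islimpt_iff_eventually eventually_at_split)
qed

lemma nonaffine_points_subset_Z:
  assumes "f \<in> PL" shows "nonaffine_points f \<subseteq> Z"
proof
  fix y assume y: "y \<in> nonaffine_points f"
  obtain \<alpha> \<beta> where *: "\<alpha> \<in> aff" "\<beta> \<in> aff" "germ f y \<alpha> \<beta>" using assms by (rule PL_germE)
  show "y \<in> Z"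
  proof (rule ccontr)
    assume "y \<notin> Z"
    with *(3) have "\<beta> = \<alpha>" by (simp add: germ_def)
    with *(3) have "\<forall>\<^sub>F z in at y. f z = \<alpha> z" unfolding germ_def eventually_at_split by simp
    moreover have "f y = \<alpha> y" using germ_value(1)[OF assms *] .
    ultimately have "\<forall>\<^sub>F z in nhds y. f z = \<alpha> z" by (simp add: eventually_nhds_conv_at)
    then show False using y *(1) by (auto simp: nonaffine_points_def)
  qed
qed

text \<open>The affine germ is locally constant, hence constant on an interval.\<close>

lemma affine_between_nonaffine_points:
  assumes "{a<..<b} \<inter> nonaffine_points f = {}"
  shows "\<exists>m c. \<forall>x\<in>{a<..<b}. f x = m * x + c"
proof -
  have "\<forall>z\<in>{a<..<b}. \<exists>\<alpha>. \<alpha> \<in> aff \<and> (\<forall>\<^sub>F w in nhds z. f w = \<alpha> w)"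
    using assms unfolding nonaffine_points_def by blast
  then obtain A where A: "\<And>z. z \<in> {a<..<b} \<Longrightarrow> A z \<in> aff"
      "\<And>z. z \<in> {a<..<b} \<Longrightarrow> \<forall>\<^sub>F w in nhds z. f w = A z w" by metis
  have "A constant_on {a<..<b}"
  proof (rule locally_constant_imp_constant)
    fix z assume z: "z \<in> {a<..<b}"
    obtain T where T: "open T" "z \<in> T" "\<And>w. w \<in> T \<Longrightarrow> f w = A z w"
      using A(2)[OF z] unfolding eventually_nhds by blast
    have "A w = A z" if w: "w \<in> T" "w \<in> {a<..<b}" for w
    proof (rule aff_eq_eventually[OF A(1)[OF w(2)] A(1)[OF z], of w])
      have "\<forall>\<^sub>F v in nhds w. A w v = A z v"
        using A(2)[OF w(2)] eventually_nhds_in_open[OF T(1) w(1)] by eventually_elim (use T in auto)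
      then show "\<forall>\<^sub>F v in at_right w. A w v = A z v"
        by (auto simp: eventually_at_filter elim: eventually_mono)
    qed
    then have "\<forall>x\<in>{a<..<b} \<inter> T. A x = A z" by blast
    moreover have "openin (top_of_set {a<..<b}) ({a<..<b} \<inter> T)" by (rule openin_open_Int[OF T(1)])
    moreover have "z \<in> {a<..<b} \<inter> T" using T(2) z by blast
    ultimately show "\<exists>T. openin (top_of_set {a<..<b}) T \<and> z \<in> T \<and> (\<forall>x\<in>T. A x = A z)" by blast
  qed simp
  from this[unfolded constant_on_def] obtain \<alpha> where "\<forall>z\<in>{a<..<b}. A z = \<alpha>" ..
  then have \<alpha>: "\<And>z. z \<in> {a<..<b} \<Longrightarrow> A z = \<alpha>" by simp
  show ?thesis
  proof (cases "{a<..<b} = {}")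
    case False
    then obtain z where "z \<in> {a<..<b}" by blast
    then obtain k c where kc: "\<alpha> = (\<lambda>x. N powi k * x + c)" using A(1) \<alpha> by (metis affE)
    have "f x = \<alpha> x" if "x \<in> {a<..<b}" for x
      using eventually_nhds_x_imp_x[OF A(2)[OF that]] \<alpha>[OF that] by simp
    then show ?thesis unfolding kc by blast
  qed auto
qed

lemma PL_in_A_group:
  assumes "f \<in> PL" shows "f \<in> carrier (A_group n)"
proof -
  let ?B = "nonaffine_points f"
  note mono = PL_strict_mono[OF assms] and surj = PL_surj[OF assms]
  have "piecewise_linear f"
    unfolding piecewise_linear_def
    using strict_mono_surj_continuous[OF mono surj] nonaffine_points_no_limit[OF assms]
      affine_between_nonaffine_points[of _ _ f] by blast
  moreover have "slopes f \<subseteq> powers_of n"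
  proof
    fix D assume "D \<in> slopes f"
    then obtain x where x: "(f has_real_derivative D) (at x)" by (auto simp: slopes_def)
    obtain \<alpha> \<beta> where *: "\<alpha> \<in> aff" "\<beta> \<in> aff" "germ f x \<alpha> \<beta>" using assms by (rule PL_germE)
    obtain k c where kc: "\<beta> = (\<lambda>x. N powi k * x + c)" using *(2) by (rule affE)
    have "((\<lambda>y. (f y - f x) / (y - x)) \<longlongrightarrow> D) (at x within {x<..})"
      using has_field_derivative_at_within[OF x, of "{x<..}"] by (simp add: has_field_derivative_iff)
    moreover have "\<forall>\<^sub>F y in at_right x. (f y - f x) / (y - x) = N powi k"
    proof -
      have r: "\<forall>\<^sub>F z in at_right x. f z = \<beta> z" using *(3) by (simp add: germ_def)
      have "\<forall>\<^sub>F z in at_right x. x < z" by (simp add: eventually_at_filter)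
      with r show ?thesis
        by eventually_elim (simp add: germ_value(2)[OF assms *] kc flip: right_diff_distrib)
    qed
    ultimately have "((\<lambda>y. N powi k) \<longlongrightarrow> D) (at_right x)" by (simp only: tendsto_cong)
    then have "D = N powi k" by (simp add: tendsto_const_iff)
    then show "D \<in> powers_of n" by (simp add: powers_of_def)
  qed
  moreover have "\<exists>D\<subseteq>Z. discrete D \<and> breaks f \<subseteq> D"
  proof (intro exI conjI)
    show "?B \<subseteq> Z" using nonaffine_points_subset_Z[OF assms] .
    show "discrete ?B"
      using nonaffine_points_no_limit[OF assms] by (simp add: discrete_def isolated_in_islimpt_iff)
    show "breaks f \<subseteq> ?B"
    proof
      fix y assume y: "y \<in> breaks f"
      show "y \<in> ?B"
      proof (rule ccontr)
        assume "y \<notin> ?B"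
        then obtain \<alpha> where \<alpha>: "\<alpha> \<in> aff" "\<forall>\<^sub>F z in nhds y. f z = \<alpha> z" by (auto simp: nonaffine_points_def)
        obtain k c where kc: "\<alpha> = (\<lambda>x. N powi k * x + c)" using \<alpha>(1) by (rule affE)
        have "\<forall>\<^sub>F w in nhds y. \<forall>\<^sub>F z in nhds w. f z = \<alpha> z"
          using \<alpha>(2) by (simp add: eventually_eventually)
        then have d: "\<forall>\<^sub>F w in nhds y. (f has_real_derivative N powi k) (at w)"
          by eventually_elim (rule aff_derivative[OF kc])
        have "\<forall>\<^sub>F w in nhds y. f differentiable at w"
          using d by eventually_elim (auto simp: real_differentiable_def)
        moreover have "\<forall>\<^sub>F w in nhds y. deriv f w = N powi k"
          using d by eventually_elim (rule DERIV_imp_deriv)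
        then have "isCont (deriv f) y" by (subst isCont_cong) auto
        ultimately show False using y by (simp add: breaks_def)
      qed
    qed
  qed
  moreover have "f ` Z = Z"
    using PL_Z_iff[OF assms] surj by (auto simp: image_iff) (metis surjD)
  ultimately show ?thesis
    using mono strict_mono_surj_homeo_R[OF mono surj] by (simp add: A_group_def)
qed

text \<open>The constant term of an affine piece lies in \<open>\<int>[1/n]\<close> because the piece maps some point of this dense
  set into the set. Off \<open>\<int>[1/n]\<close> there is no break, so the slopes on the two sides agree as limits of
  the derivative.\<close>

lemma A_group_in_PL:
  assumes "f \<in> carrier (A_group n)" shows "f \<in> PL"
proof -
  have A: "homeo_R f" "strict_mono f" "piecewise_linear f" "slopes f \<subseteq> powers_of n"
      "\<exists>D\<subseteq>Z. discrete D \<and> breaks f \<subseteq> D" "f ` Z = Z"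
    using assms unfolding A_group_def by simp_all
  note mono = A(2) and sl = A(4) and fZ = A(6)
  obtain D where D: "D \<subseteq> Z" "breaks f \<subseteq> D" using A(5) by blast
  obtain B where B: "\<And>x. \<not> x islimpt B"
      "\<And>a b. {a<..<b} \<inter> B = {} \<Longrightarrow> \<exists>m c. \<forall>x\<in>{a<..<b}. f x = m * x + c"
    using A(3) unfolding piecewise_linear_def by blast
  have surj: "surj f" using A(1) unfolding homeo_R_def homeomorphism_def by blast
  note cont = strict_mono_surj_isCont[OF mono surj]
  have piece: "\<exists>\<alpha>\<in>aff. \<forall>x\<in>{a<..<b}. f x = \<alpha> x" if ab: "a < b" "{a<..<b} \<inter> B = {}" for a b
  proof -
    obtain m c where mc: "\<And>x. x \<in> {a<..<b} \<Longrightarrow> f x = m * x + c" using B(2)[OF ab(2)] by blast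
    obtain z where z: "z \<in> Z" "a < z" "z < b" using Z_dense[OF ab(1)] .
    have "\<forall>\<^sub>F w in nhds z. f w = m * w + c"
      using eventually_nhds_in_open[of "{a<..<b}" z] z mc by (auto elim: eventually_mono)
    then have "(f has_real_derivative m) (at z) \<longleftrightarrow> ((\<lambda>w. m * w + c) has_real_derivative m) (at z)"
      by (intro DERIV_cong_ev) auto
    moreover have "((\<lambda>w. m * w + c) has_real_derivative m) (at z)" by (auto intro!: derivative_eq_intros)
    ultimately have "m \<in> powers_of n" using sl by (auto simp: slopes_def)
    then obtain k where k: "m = N powi k" by (auto simp: powers_of_def)
    have "f z \<in> Z" using fZ z(1) by blast
    moreover have "c = f z - m * z" using mc[of z] z by simp
    ultimately have "c \<in> Z" using Z_diff[OF _ Z_mult[OF Z_powi[of k] z(1)]] k by simp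
    then show ?thesis using mc k affI[of c k] by (intro bexI[of _ "\<lambda>x. N powi k * x + c"]) auto
  qed
  show ?thesis
    unfolding PL_def
  proof (intro CollectI conjI allI mono surj)
    fix y
    have ev: "\<forall>\<^sub>F z in at y. z \<notin> B" using B(1)[of y] by (simp add: islimpt_iff_eventually)
    obtain b where b: "b > y" "\<And>z. y < z \<Longrightarrow> z < b \<Longrightarrow> z \<notin> B"
      using ev unfolding eventually_at_split eventually_at_right_field by blast
    obtain a where a: "a < y" "\<And>z. a < z \<Longrightarrow> z < y \<Longrightarrow> z \<notin> B"
      using ev unfolding eventually_at_split eventually_at_left_field by blast
    have "{y<..<b} \<inter> B = {}" "{a<..<y} \<inter> B = {}" using a(2) b(2) by auto
    with piece[OF b(1)] piece[OF a(1)] obtain \<alpha> \<beta>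
      where \<alpha>: "\<alpha> \<in> aff" "\<forall>x\<in>{a<..<y}. f x = \<alpha> x"
        and \<beta>: "\<beta> \<in> aff" "\<forall>x\<in>{y<..<b}. f x = \<beta> x" by blast
    have r: "\<forall>\<^sub>F z in at_right y. f z = \<beta> z" unfolding eventually_at_right_field using \<beta> b by auto
    have l: "\<forall>\<^sub>F z in at_left y. f z = \<alpha> z" unfolding eventually_at_left_field using \<alpha> a by auto
    have "\<alpha> = \<beta>" if "y \<notin> Z"
    proof -
      have "y \<notin> breaks f" using that D by blast
      then have c: "isCont (deriv f) y" by (simp add: breaks_def)
      have c': "(g \<longlongrightarrow> g y) (at y within S)" if "isCont g y" for g :: "real \<Rightarrow> real" and S
        using that unfolding isCont_def by (rule tendsto_within_subset) auto
      obtain k c where \<alpha>': "\<alpha> = (\<lambda>x. N powi k * x + c)" using \<alpha>(1) by (rule affE)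
      obtain l d where \<beta>': "\<beta> = (\<lambda>x. N powi l * x + d)" using \<beta>(1) by (rule affE)
      have "deriv f z = N powi l" if "y < z" "z < b" for z
        using eventually_nhds_in_open[of "{y<..<b}" z] that \<beta>(2)
        by (intro DERIV_imp_deriv aff_derivative[OF \<beta>']) (auto elim: eventually_mono)
      then have "\<forall>\<^sub>F z in at_right y. deriv f z = N powi l"
        unfolding eventually_at_right_field using b by blast
      from tendsto_cong[THEN iffD1, OF this c'[OF c]]
      have 1: "deriv f y = N powi l" by (simp add: tendsto_const_iff)
      have "deriv f z = N powi k" if "a < z" "z < y" for z
        using eventually_nhds_in_open[of "{a<..<y}" z] that \<alpha>(2)
        by (intro DERIV_imp_deriv aff_derivative[OF \<alpha>']) (auto elim: eventually_mono)
      then have "\<forall>\<^sub>F z in at_left y. deriv f z = N powi k"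
        unfolding eventually_at_left_field using a by blast
      from tendsto_cong[THEN iffD1, OF this c'[OF c]]
      have 2: "deriv f y = N powi k" by (simp add: tendsto_const_iff)
      have "f y = \<beta> y"
        by (rule tendsto_unique[OF trivial_limit_at_right_real tendsto_cong[THEN iffD1, OF r c'[OF cont]] c'])
          (simp add: \<beta>')
      moreover have "f y = \<alpha> y"
        by (rule tendsto_unique[OF trivial_limit_at_left_real tendsto_cong[THEN iffD1, OF l c'[OF cont]] c'])
          (simp add: \<alpha>')
      ultimately show ?thesis using 1 2 by (simp add: \<alpha>' \<beta>')
    qed
    then show "\<exists>\<alpha>\<in>aff. \<exists>\<beta>\<in>aff. germ f y \<alpha> \<beta>"
      using \<alpha>(1) \<beta>(1) l r unfolding germ_def by blast
  qed
qed

lemma carrier_A_group: "carrier (A_group n) = PL"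
  using PL_in_A_group A_group_in_PL by blast

lemma A_group_simps [simp]:
  "mult (A_group n) f g = g \<circ> f" "one (A_group n) = id"
  by (simp_all add: A_group_def)

lemma finv_comp:
  assumes "f \<in> PL" shows "finv f \<circ> f = id" "f \<circ> finv f = id"
  using PL_bij[OF assms] by (auto simp: bij_def inj_iff surj_iff)

lemma group_A_group: "group (A_group n)"
proof (rule groupI)
  fix f assume "f \<in> carrier (A_group n)"
  then have "f \<in> PL" by (simp add: carrier_A_group)
  then show "\<exists>g\<in>carrier (A_group n). g \<otimes>\<^bsub>A_group n\<^esub> f = \<one>\<^bsub>A_group n\<^esub>"
    using PL_inverse finv_comp by (intro bexI[of _ "finv f"]) (auto simp: carrier_A_group)
qed (auto simp: carrier_A_group PL_compose PL_id comp_assoc)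

lemma inv_A_group:
  assumes "f \<in> PL" shows "inv\<^bsub>A_group n\<^esub> f = finv f"
  by (rule group.inv_equality[OF group_A_group])
    (use assms in \<open>auto simp: carrier_A_group PL_inverse finv_comp\<close>)

section \<open>Conjugators of expanding maps\<close>

definition unit_homeos :: "(real \<Rightarrow> real) set" where
  "unit_homeos = {\<phi>. strict_mono \<phi> \<and> surj \<phi> \<and> (\<forall>x. x \<le> 0 \<or> 1 \<le> x \<longrightarrow> \<phi> x = x)}"

lemma unit_homeos_id: "id \<in> unit_homeos"
  by (simp add: unit_homeos_def strict_mono_def)

lemma unit_homeos_outside: "\<phi> \<in> unit_homeos \<Longrightarrow> x \<le> 0 \<or> 1 \<le> x \<Longrightarrow> \<phi> x = x"
  by (auto simp: unit_homeos_def)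

lemma unit_homeos_less_iff: "\<phi> \<in> unit_homeos \<Longrightarrow> \<phi> x < \<phi> y \<longleftrightarrow> x < y"
  by (auto simp: unit_homeos_def strict_mono_less)

lemma unit_homeos_bounds:
  assumes "\<phi> \<in> unit_homeos"
  shows "0 < \<phi> x \<longleftrightarrow> 0 < x" "\<phi> x < 1 \<longleftrightarrow> x < 1"
  using unit_homeos_less_iff[OF assms] unit_homeos_outside[OF assms] by (metis order_refl)+

lemma unit_homeos_compose: "\<phi> \<in> unit_homeos \<Longrightarrow> \<psi> \<in> unit_homeos \<Longrightarrow> \<phi> \<circ> \<psi> \<in> unit_homeos"
  using strict_mono_surj_compose[of \<phi> \<psi>] by (auto simp: unit_homeos_def)

lemma unit_homeos_bij: "\<phi> \<in> unit_homeos \<Longrightarrow> bij \<phi>"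
  using strict_mono_surj_bij by (auto simp: unit_homeos_def)

lemma unit_homeos_inverse: "\<phi> \<in> unit_homeos \<Longrightarrow> finv \<phi> \<in> unit_homeos"
  using strict_mono_surj_inv[of \<phi>] unit_homeos_bij[of \<phi>]
  unfolding unit_homeos_def by (simp add: bij_def inv_f_eq)

text \<open>Copies of \<open>\<phi>\<close> on the unit intervals that correspond to the digit \<open>1\<close>.\<close>

definition spread :: "(real \<Rightarrow> real) \<Rightarrow> real \<Rightarrow> real" where
  "spread \<phi> y = (if \<lfloor>y\<rfloor> mod n = 1 then of_int \<lfloor>y\<rfloor> + \<phi> (y - of_int \<lfloor>y\<rfloor>) else y)"

lemma spread_on:
  assumes "\<phi> \<in> unit_homeos" "of_int k \<le> y" "y \<le> of_int k + 1"
  shows "spread \<phi> y = (if k mod n = 1 then of_int k + \<phi> (y - of_int k) else y)"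
proof (cases "y = of_int k + 1")
  case True
  then have "\<lfloor>y\<rfloor> = k + 1" by linarith
  then show ?thesis using True assms(1) by (simp add: spread_def unit_homeos_outside)
next
  case False
  then have "\<lfloor>y\<rfloor> = k" using assms by (simp add: floor_eq_iff)
  then show ?thesis by (simp add: spread_def)
qed

lemma spread_floor:
  assumes "\<phi> \<in> unit_homeos"
  shows "of_int \<lfloor>y\<rfloor> \<le> spread \<phi> y" "spread \<phi> y < of_int \<lfloor>y\<rfloor> + 1"
proof -
  have *: "0 \<le> \<phi> (y - of_int \<lfloor>y\<rfloor>)" "\<phi> (y - of_int \<lfloor>y\<rfloor>) < 1"
    using unit_homeos_bounds[OF assms, of "y - of_int \<lfloor>y\<rfloor>"] unit_homeos_outside[OF assms, of 0]
      floor_correct[of y] by (cases "y = of_int \<lfloor>y\<rfloor>"; simp)+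
  then show "of_int \<lfloor>y\<rfloor> \<le> spread \<phi> y" "spread \<phi> y < of_int \<lfloor>y\<rfloor> + 1"
    using floor_correct[of y] by (auto simp: spread_def)
qed

lemma floor_spread: "\<phi> \<in> unit_homeos \<Longrightarrow> \<lfloor>spread \<phi> y\<rfloor> = \<lfloor>y\<rfloor>"
  using spread_floor[of \<phi> y] by (simp add: floor_eq_iff)

lemma spread_near: "\<phi> \<in> unit_homeos \<Longrightarrow> \<bar>spread \<phi> y - y\<bar> \<le> 1"
  using spread_floor[of \<phi> y] floor_correct[of y] by linarith

lemma spread_strict_mono:
  assumes "\<phi> \<in> unit_homeos" shows "strict_mono (spread \<phi>)"
proof (rule strict_monoI)
  fix x y :: real assume "x < y"
  show "spread \<phi> x < spread \<phi> y"
  proof (cases "\<lfloor>x\<rfloor> = \<lfloor>y\<rfloor>")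
    case True
    then show ?thesis using \<open>x < y\<close> unit_homeos_less_iff[OF assms] by (simp add: spread_def)
  next
    case False
    then have "\<lfloor>x\<rfloor> + 1 \<le> \<lfloor>y\<rfloor>" using floor_mono[of x y] \<open>x < y\<close> by linarith
    then have "of_int \<lfloor>x\<rfloor> + 1 \<le> (of_int \<lfloor>y\<rfloor> :: real)" by linarith
    then show ?thesis using spread_floor[OF assms, of x] spread_floor[OF assms, of y] by linarith
  qed
qed

lemma spread_id [simp]: "spread id = id"
  by (auto simp: spread_def)

lemma spread_compose:
  assumes "\<phi> \<in> unit_homeos" "\<psi> \<in> unit_homeos"
  shows "spread (\<phi> \<circ> \<psi>) = spread \<phi> \<circ> spread \<psi>"
proof
  fix y
  have "spread \<phi> (spread \<psi> y) = (if \<lfloor>y\<rfloor> mod n = 1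
      then of_int \<lfloor>y\<rfloor> + \<phi> (spread \<psi> y - of_int \<lfloor>y\<rfloor>) else spread \<psi> y)"
    unfolding spread_def[of \<phi> "spread \<psi> y"] floor_spread[OF assms(2)] ..
  then show "spread (\<phi> \<circ> \<psi>) y = (spread \<phi> \<circ> spread \<psi>) y"
    by (simp add: spread_def)
qed

lemma spread_surj:
  assumes "\<phi> \<in> unit_homeos" shows "surj (spread \<phi>)"
proof -
  have "\<phi> \<circ> finv \<phi> = id"
    using unit_homeos_bij[OF assms] by (simp add: bij_def surj_iff)
  then have "spread \<phi> \<circ> spread (finv \<phi>) = id"
    using spread_compose[OF assms unit_homeos_inverse[OF assms]] by simp
  then show ?thesis by (metis comp_apply id_apply surjI)
qed

lemma spread_translate: "spread \<phi> (y + of_int (n * j)) = spread \<phi> y + of_int (n * j)"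
proof -
  have "\<lfloor>y + of_int (n * j)\<rfloor> = \<lfloor>y\<rfloor> + n * j" by (rule floor_add_int[symmetric])
  then show ?thesis by (simp add: spread_def)
qed

lemma spread_PL:
  assumes "\<phi> \<in> unit_homeos" "\<phi> \<in> PL" shows "spread \<phi> \<in> PL"
proof (rule PL_glue[OF spread_strict_mono[OF assms(1)] spread_surj[OF assms(1)]])
  fix y :: real
  define g where "g k = (\<lambda>z. if k mod n = 1 then of_int k + \<phi> (z - of_int k) else z)" for k :: int
  have g: "g k \<in> PL" for k
  proof (cases "k mod n = 1")
    case True
    have 1: "(\<lambda>z. z + of_int k) \<in> PL" using aff_subset_PL[OF aff_translation, of "of_int k"] by simp
    have 2: "(\<lambda>z. z + - of_int k) \<in> PL"
      using aff_subset_PL[OF aff_translation, of "- of_int k"] Z_uminus by simp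
    have "g k = (\<lambda>z. z + of_int k) \<circ> (\<phi> \<circ> (\<lambda>z. z + - of_int k))" using True by (auto simp: g_def)
    then show ?thesis using PL_compose[OF 1 PL_compose[OF assms(2) 2]] by simp
  qed (use PL_id in \<open>auto simp: g_def id_def\<close>)
  have on: "spread \<phi> z = g k z" if "of_int k \<le> z" "z \<le> of_int k + 1" for k z
    using spread_on[OF assms(1) that] by (simp add: g_def)
  let ?k = "\<lfloor>y\<rfloor>"
  have r: "\<forall>\<^sub>F z in at_right y. spread \<phi> z = g ?k z"
    unfolding eventually_at_right_field
  proof (intro exI conjI allI impI)
    show "y < of_int ?k + 1" by linarith
    fix z assume "y < z" "z < of_int ?k + 1"
    moreover have "of_int ?k \<le> y" by linarith
    ultimately show "spread \<phi> z = g ?k z" by (intro on) linarith+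
  qed
  show "\<exists>\<alpha>\<in>PL. \<exists>\<beta>\<in>PL. germ (spread \<phi>) y \<alpha> \<beta>"
  proof (cases "y = of_int ?k")
    case True
    have "\<forall>\<^sub>F z in at_left y. spread \<phi> z = g (?k - 1) z"
      unfolding eventually_at_left_field using True
      by (intro exI[of _ "y - 1"]) (auto intro!: on)
    moreover have "y \<in> Z" using True Z_of_int by metis
    ultimately show ?thesis using r g unfolding germ_def by blast
  next
    case False
    then have "of_int ?k < y" by linarith
    then have "\<forall>\<^sub>F z in at_left y. spread \<phi> z = g ?k z"
      unfolding eventually_at_left_field
    proof (intro exI conjI allI impI)
      fix z assume "of_int ?k < z" "z < y"
      moreover have "y < of_int ?k + 1" by linarith
      ultimately show "spread \<phi> z = g ?k z" by (intro on) linarith+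
    qed
    then show ?thesis using r g unfolding germ_def by blast
  qed
qed

definition expand :: "(real \<Rightarrow> real) \<Rightarrow> real \<Rightarrow> real" where
  "expand \<phi> x = spread \<phi> (N * x)"

text \<open>The conjugacy from the expanding map \<^term>\<open>expand \<phi>\<close> to multiplication by \<open>n\<close>.\<close>

definition conjugator :: "(real \<Rightarrow> real) \<Rightarrow> real \<Rightarrow> real" where
  "conjugator \<phi> x = lim (\<lambda>k. (expand \<phi> ^^ k) x / N ^ k)"

text \<open>Consecutive terms differ by at most \<open>1 / n ^ (k + 1)\<close> since \<^term>\<open>expand \<phi> y\<close> is within distance 1 of \<open>n y\<close>.\<close>

lemma conjugator_LIMSEQ:
  assumes "\<phi> \<in> unit_homeos"
  shows "(\<lambda>k. (expand \<phi> ^^ k) x / N ^ k) \<longlonglongrightarrow> conjugator \<phi> x"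
proof -
  define a where "a k = (expand \<phi> ^^ k) x / N ^ k" for k
  have le: "norm (a (Suc k) - a k) \<le> (1 / N) ^ Suc k" for k
  proof -
    have "a (Suc k) - a k = (spread \<phi> (N * (expand \<phi> ^^ k) x) - N * (expand \<phi> ^^ k) x) / N ^ Suc k"
      by (simp add: a_def expand_def field_simps)
    then show ?thesis
      using spread_near[OF assms, of "N * (expand \<phi> ^^ k) x"]
      by (simp add: abs_divide power_one_over del: power_Suc) (rule divide_right_mono, simp_all del: power_Suc)
  qed
  have "summable (\<lambda>k. (1 / N) ^ Suc k)"
    using N_ge_2 by (subst summable_Suc_iff) (auto intro: summable_geometric)
  then have "summable (\<lambda>k. a (Suc k) - a k)" by (rule summable_comparison_test') (rule le)
  then have "(\<lambda>m. \<Sum>k<m. a (Suc k) - a k) \<longlonglongrightarrow> (\<Sum>k. a (Suc k) - a k)" by (rule summable_LIMSEQ)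
  then have "(\<lambda>m. a m - a 0) \<longlonglongrightarrow> (\<Sum>k. a (Suc k) - a k)" by (simp only: sum_lessThan_telescope)
  from tendsto_add[OF this tendsto_const[of "a 0"]]
  have "a \<longlonglongrightarrow> (\<Sum>k. a (Suc k) - a k) + a 0" by simp
  then have "convergent a" by (auto simp: convergent_def)
  then show ?thesis unfolding conjugator_def a_def convergent_LIMSEQ_iff .
qed

lemma expand_translate: "expand \<phi> (x + of_int j) = expand \<phi> x + of_int (n * j)"
  using spread_translate[of \<phi> "N * x" j] by (simp add: expand_def algebra_simps)

lemma conjugator_expand:
  assumes "\<phi> \<in> unit_homeos" shows "conjugator \<phi> (expand \<phi> x) = N * conjugator \<phi> x"
proof (rule LIMSEQ_unique[OF conjugator_LIMSEQ[OF assms]])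
  have "(\<lambda>k. N * ((expand \<phi> ^^ Suc k) x / N ^ Suc k)) \<longlonglongrightarrow> N * conjugator \<phi> x"
    by (intro tendsto_mult tendsto_const LIMSEQ_Suc conjugator_LIMSEQ assms)
  then show "(\<lambda>k. (expand \<phi> ^^ k) (expand \<phi> x) / N ^ k) \<longlonglongrightarrow> N * conjugator \<phi> x"
    by (simp add: funpow_swap1)
qed

lemma conjugator_mono:
  assumes "\<phi> \<in> unit_homeos" "x \<le> y" shows "conjugator \<phi> x \<le> conjugator \<phi> y"
proof (rule LIMSEQ_le[OF conjugator_LIMSEQ[OF assms(1)] conjugator_LIMSEQ[OF assms(1)]])
  have "(expand \<phi> ^^ k) x \<le> (expand \<phi> ^^ k) y" for k
    using assms(2) spread_strict_mono[OF assms(1)]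
    by (induction k) (auto simp: expand_def strict_mono_less_eq)
  then show "\<exists>M. \<forall>k\<ge>M. (expand \<phi> ^^ k) x / N ^ k \<le> (expand \<phi> ^^ k) y / N ^ k"
    by (intro exI[of _ 0] allI impI divide_right_mono) simp_all
qed

lemma conjugator_translate:
  assumes "\<phi> \<in> unit_homeos" shows "conjugator \<phi> (x + of_int j) = conjugator \<phi> x + of_int j"
proof (rule LIMSEQ_unique[OF conjugator_LIMSEQ[OF assms]])
  have "(expand \<phi> ^^ k) (x + of_int j) = (expand \<phi> ^^ k) x + of_int (n ^ k * j)" for k
  proof (induction k)
    case (Suc k)
    have "(expand \<phi> ^^ Suc k) (x + of_int j) = expand \<phi> ((expand \<phi> ^^ k) x + of_int (n ^ k * j))"
      using Suc by simp
    also have "\<dots> = expand \<phi> ((expand \<phi> ^^ k) x) + of_int (n * (n ^ k * j))"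
      by (rule expand_translate)
    finally show ?case by (simp add: mult.assoc)
  qed simp
  then have *: "(expand \<phi> ^^ k) (x + of_int j) / N ^ k = (expand \<phi> ^^ k) x / N ^ k + of_int j" for k
    by (simp add: add_divide_distrib)
  show "(\<lambda>k. (expand \<phi> ^^ k) (x + of_int j) / N ^ k) \<longlonglongrightarrow> conjugator \<phi> x + of_int j"
    unfolding * by (intro tendsto_add tendsto_const conjugator_LIMSEQ assms)
qed

lemma conjugator_near:
  assumes "\<phi> \<in> unit_homeos" shows "\<bar>conjugator \<phi> x - x\<bar> \<le> 1"
proof -
  \<comment> \<open>the summand \<open>- 1\<close> makes the induction work: \<open>1 + n (n ^ k - 1) \<le> n ^ (k + 1) - 1\<close>\<close>
  have "\<bar>(expand \<phi> ^^ k) x - N ^ k * x\<bar> \<le> N ^ k - 1" for k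
  proof (induction k)
    case (Suc k)
    let ?y = "(expand \<phi> ^^ k) x"
    have "(expand \<phi> ^^ Suc k) x - N ^ Suc k * x = (spread \<phi> (N * ?y) - N * ?y) + N * (?y - N ^ k * x)"
      by (simp add: expand_def algebra_simps)
    moreover have "\<bar>N * (?y - N ^ k * x)\<bar> \<le> N * (N ^ k - 1)"
      using Suc N_ge_2 by (simp add: abs_mult)
    moreover note spread_near[OF assms, of "N * ?y"]
    ultimately have "\<bar>(expand \<phi> ^^ Suc k) x - N ^ Suc k * x\<bar> \<le> 1 + N * (N ^ k - 1)"
      by linarith
    then show ?case using N_ge_2 by (simp add: algebra_simps)
  qed simp
  then have *: "\<bar>(expand \<phi> ^^ k) x / N ^ k - x\<bar> \<le> 1" for k
  proof -
    have "(expand \<phi> ^^ k) x / N ^ k - x = ((expand \<phi> ^^ k) x - N ^ k * x) / N ^ k"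
      by (simp add: diff_divide_distrib)
    moreover have "\<bar>(expand \<phi> ^^ k) x - N ^ k * x\<bar> \<le> N ^ k"
      using \<open>\<bar>(expand \<phi> ^^ k) x - N ^ k * x\<bar> \<le> N ^ k - 1\<close> by linarith
    ultimately show ?thesis by (simp add: abs_divide)
  qed
  show ?thesis
    by (rule LIMSEQ_le_const2[OF tendsto_rabs[OF tendsto_diff[OF conjugator_LIMSEQ[OF assms] tendsto_const]]])
      (use * in auto)
qed

text \<open>Two solutions differ by a bounded function \<open>d\<close> with \<open>d (expand \<phi> x) = n d x\<close>. Iterating forces \<open>d = 0\<close>.
  All identities between conjugators are derived from this.\<close>

lemma conjugator_unique:
  assumes "\<phi> \<in> unit_homeos" and u: "\<And>x. u (expand \<phi> x) = N * u x" "\<And>x. \<bar>u x - x\<bar> \<le> C"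
  shows "u = conjugator \<phi>"
proof
  fix x
  have *: "v ((expand \<phi> ^^ k) x) = N ^ k * v x" if "\<And>x. v (expand \<phi> x) = N * v x" for v k
    using that by (induction k) auto
  have "\<bar>u x - conjugator \<phi> x\<bar> \<le> (C + 1) * (1 / N) ^ k" for k
  proof -
    let ?y = "(expand \<phi> ^^ k) x"
    have "\<bar>u ?y - conjugator \<phi> ?y\<bar> \<le> C + 1"
      using u(2)[of ?y] conjugator_near[OF assms(1), of ?y] by linarith
    moreover have "u ?y - conjugator \<phi> ?y = N ^ k * (u x - conjugator \<phi> x)"
      using *[of u] *[of "conjugator \<phi>"] u(1) conjugator_expand[OF assms(1)]
      by (simp add: right_diff_distrib)
    ultimately have "N ^ k * \<bar>u x - conjugator \<phi> x\<bar> \<le> C + 1" by (simp add: abs_mult abs_of_pos)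
    then show ?thesis by (simp add: power_one_over pos_le_divide_eq mult.commute)
  qed
  moreover have "(\<lambda>k. (C + 1) * (1 / N) ^ k) \<longlonglongrightarrow> (C + 1) * 0"
    using N_ge_2 by (intro tendsto_mult tendsto_const LIMSEQ_realpow_zero) auto
  ultimately have "\<bar>u x - conjugator \<phi> x\<bar> \<le> (C + 1) * 0" by (intro LIMSEQ_le_const) auto
  then show "u x = conjugator \<phi> x" by simp
qed

lemma conjugator_id: "conjugator id = id"
  by (rule conjugator_unique[symmetric, of _ _ 0]) (auto simp: unit_homeos_id expand_def)

lemma conjugator_of_int:
  assumes "\<phi> \<in> unit_homeos" shows "conjugator \<phi> (of_int j) = of_int j"
proof -
  have "expand \<phi> 0 = 0" using n_ge_2 by (simp add: expand_def spread_def)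
  then have "conjugator \<phi> 0 = N * conjugator \<phi> 0" using conjugator_expand[OF assms, of 0] by simp
  then have "(N - 1) * conjugator \<phi> 0 = 0" by (simp add: algebra_simps)
  then have "conjugator \<phi> 0 = 0" using N_ge_2 by simp
  then show ?thesis using conjugator_translate[OF assms, of 0 j] by simp
qed

lemma conjugator_between:
  assumes "\<phi> \<in> unit_homeos" "of_int i \<le> x" "x \<le> of_int j"
  shows "of_int i \<le> conjugator \<phi> x" "conjugator \<phi> x \<le> of_int j"
  using conjugator_mono[OF assms(1,2)] conjugator_mono[OF assms(1,3)]
  by (simp_all add: conjugator_of_int[OF assms(1)])

text \<open>The maps \<open>\<phi>\<close> that commute with the conjugators of all \<open>\<psi>\<close>. The conjugator of such a \<open>\<phi>\<close> satisfies a
  second functional equation, with \<open>\<kappa>\<close> acting on the target, and \<open>\<phi> \<mapsto> conjugator \<phi>\<close> is multiplicative.\<close>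

definition central :: "(real \<Rightarrow> real) set" where
  "central = {\<phi> \<in> unit_homeos. \<forall>\<psi>\<in>unit_homeos. conjugator \<psi> \<circ> \<phi> = \<phi> \<circ> conjugator \<psi>}"

lemma central_unit_homeos: "\<phi> \<in> central \<Longrightarrow> \<phi> \<in> unit_homeos"
  by (simp add: central_def)

lemma central_commute:
  "\<phi> \<in> central \<Longrightarrow> \<psi> \<in> unit_homeos \<Longrightarrow> conjugator \<psi> (\<phi> x) = \<phi> (conjugator \<psi> x)"
  by (auto simp: central_def fun_eq_iff)

lemma central_id: "id \<in> central"
  by (simp add: central_def unit_homeos_id)

lemma central_compose: "\<phi> \<in> central \<Longrightarrow> \<psi> \<in> central \<Longrightarrow> \<phi> \<circ> \<psi> \<in> central"
  by (auto simp: central_def unit_homeos_compose fun_eq_iff)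

lemma central_inverse:
  assumes "\<phi> \<in> central" shows "finv \<phi> \<in> central"
  unfolding central_def
proof (intro CollectI conjI ballI ext)
  note u = central_unit_homeos[OF assms]
  show "finv \<phi> \<in> unit_homeos" using unit_homeos_inverse[OF u] .
  fix \<psi> x assume "\<psi> \<in> unit_homeos"
  from central_commute[OF assms this, of "finv \<phi> x"]
  show "(conjugator \<psi> \<circ> finv \<phi>) x = (finv \<phi> \<circ> conjugator \<psi>) x"
    using unit_homeos_bij[OF u] by (metis bij_inv_eq_iff comp_apply)
qed

lemma central_spread_commute:
  assumes "\<phi> \<in> central" "\<psi> \<in> unit_homeos"
  shows "conjugator \<psi> (spread \<phi> y) = spread \<phi> (conjugator \<psi> y)"
proof -
  let ?k = "\<lfloor>y\<rfloor>"
  note u = central_unit_homeos[OF assms(1)]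
  have k: "of_int ?k \<le> y" "y \<le> of_int ?k + 1" by linarith+
  have k': "of_int ?k \<le> conjugator \<psi> y" "conjugator \<psi> y \<le> of_int ?k + 1"
    using conjugator_between[OF assms(2), of ?k y "?k + 1"] k by simp_all
  have "conjugator \<psi> (of_int ?k + \<phi> (y - of_int ?k)) = of_int ?k + \<phi> (conjugator \<psi> y - of_int ?k)"
    using conjugator_translate[OF assms(2), of "\<phi> (y - of_int ?k)" ?k]
      conjugator_translate[OF assms(2), of "y - of_int ?k" ?k]
      central_commute[OF assms, of "y - of_int ?k"]
    by (simp add: add.commute)
  then show ?thesis
    unfolding spread_on[OF u k] spread_on[OF u k'] by simp
qed

lemma conjugator_spread:
  assumes "\<phi> \<in> central" shows "N * conjugator \<phi> x = spread \<phi> (conjugator \<phi> (N * x))"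
  using conjugator_expand[OF central_unit_homeos[OF assms], of x]
    central_spread_commute[OF assms central_unit_homeos[OF assms], of "N * x"]
  by (simp add: expand_def)

lemma conjugator_compose:
  assumes "\<phi> \<in> central" "\<psi> \<in> central"
  shows "conjugator (\<phi> \<circ> \<psi>) = conjugator \<phi> \<circ> conjugator \<psi>"
proof (rule conjugator_unique[symmetric, of _ _ 2])
  note u = central_unit_homeos[OF assms(1)] central_unit_homeos[OF assms(2)]
  show "\<phi> \<circ> \<psi> \<in> unit_homeos" using unit_homeos_compose u by blast
  fix x
  have "conjugator \<psi> (expand (\<phi> \<circ> \<psi>) x) = spread \<phi> (conjugator \<psi> (spread \<psi> (N * x)))"
    using central_spread_commute[OF assms(1) u(2)]
    by (simp add: expand_def spread_compose[OF u])
  also have "\<dots> = expand \<phi> (conjugator \<psi> x)"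
    using conjugator_expand[OF u(2), of x] by (simp add: expand_def)
  finally show "(conjugator \<phi> \<circ> conjugator \<psi>) (expand (\<phi> \<circ> \<psi>) x) = N * (conjugator \<phi> \<circ> conjugator \<psi>) x"
    using conjugator_expand[OF u(1)] by simp
  show "\<bar>(conjugator \<phi> \<circ> conjugator \<psi>) x - x\<bar> \<le> 2"
    using conjugator_near[OF u(2), of x] conjugator_near[OF u(1), of "conjugator \<psi> x"] by simp
qed

text \<open>Bijectivity comes from multiplicativity: the conjugator of the inverse is a two-sided inverse.
  Continuity then follows from monotonicity.\<close>

lemma conjugator_homeo:
  assumes "\<phi> \<in> central"
  shows conjugator_inverse: "conjugator (finv \<phi>) = finv (conjugator \<phi>)"
    and conjugator_strict_mono: "strict_mono (conjugator \<phi>)"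
    and conjugator_surj: "surj (conjugator \<phi>)"
    and conjugator_bij: "bij (conjugator \<phi>)"
proof -
  note u = central_unit_homeos[OF assms]
  have "\<phi> \<circ> finv \<phi> = id" "finv \<phi> \<circ> \<phi> = id"
    using unit_homeos_bij[OF u] by (simp_all add: bij_def surj_iff inj_iff)
  then have 1: "conjugator \<phi> \<circ> conjugator (finv \<phi>) = id" "conjugator (finv \<phi>) \<circ> conjugator \<phi> = id"
    using conjugator_compose[OF assms central_inverse[OF assms]]
      conjugator_compose[OF central_inverse[OF assms] assms] conjugator_id by simp_all
  show b: "bij (conjugator \<phi>)" using 1 by (rule o_bij[rotated])
  then show "surj (conjugator \<phi>)" by (rule bij_is_surj)
  show "conjugator (finv \<phi>) = finv (conjugator \<phi>)" using 1 by (rule inv_unique_comp[symmetric])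
  show "strict_mono (conjugator \<phi>)"
    using conjugator_mono[OF u] b
    by (auto simp: strict_mono_def less_le bij_def inj_eq)
qed

end

section \<open>A copy of two generators of F on the unit interval\<close>

locale n_adic_3 = n_adic +
  assumes n_ge_3: "3 \<le> n"
begin

lemma N_ge_3: "3 \<le> N"
  using n_ge_3 by simp

text \<open>The affine map of the unit interval onto its last subinterval of length \<open>1 / n\<close>.\<close>

definition shrink :: "real \<Rightarrow> real" where
  "shrink x = 1 - (1 - x) / N"

text \<open>The n-adic counterpart of a standard generator of \<open>F\<close> on \<open>[0, 1]\<close>. In base \<open>n\<close>, writing \<open>e = n - 1\<close>, it replaces the
  initial digits \<open>00, 0e, e\<close> by \<open>0, e0, ee\<close>, carrying the middle parts along.\<close>

definition shift :: "real \<Rightarrow> real" where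
  "shift x = (if x \<le> 0 then x else if x \<le> 1 / N - 1 / N\<^sup>2 then N * x
     else if x \<le> 1 / N then x + (1 - 2 / N + 1 / N\<^sup>2) else if x \<le> 1 then shrink x else x)"

text \<open>The map \<^term>\<open>shift\<close> transported to the last subinterval of length \<open>1 / n\<close>: the counterpart of the
  other standard generator of \<open>F\<close>. Under \<open>cantor\<close> below it corresponds to \<open>g\<^sub>0\<close>, which doubles \<open>[0, 1]\<close>.\<close>

definition double :: "real \<Rightarrow> real" where
  "double x = shrink (shift (N * x - (N - 1)))"

lemma N_ineqs: "0 < 1 / N" "1 / N < 1" "1 / N\<^sup>2 < 1 / N" "0 < 1 / N\<^sup>2" "3 * (1 / N\<^sup>2) \<le> 1 / N" "3 * (1 / N) \<le> 1"
  using N_ge_3 by (auto simp: field_simps power2_eq_square)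

lemma N_mult_break: "N * (1 / N - 1 / N\<^sup>2) = 1 - 1 / N"
  by (simp add: field_simps power2_eq_square)

lemma shrink_PL: "shrink \<in> PL"
proof -
  have "shrink = (\<lambda>x. N powi (-1) * x + (1 - 1 / N))"
    by (auto simp: shrink_def field_simps)
  moreover have "1 - 1 / N \<in> Z" by (intro Z_diff) auto
  ultimately show ?thesis using affI[of "1 - 1 / N" "-1"] aff_subset_PL by simp
qed

lemma shift_PL: "shift \<in> PL"
proof -
  let ?q = "1 / N - 1 / N\<^sup>2"
  have 2: "1 / N\<^sup>2 \<in> Z" using Z_powi[of "-2"] by (simp add: power_int_minus divide_inverse)
  have b1: "?q \<in> Z" using 2 by (intro Z_diff) auto
  have s: "1 - 2 / N + 1 / N\<^sup>2 \<in> Z" using 2 Z_mult[of 2 "1 / N"] by (intro Z_diff Z_add) auto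
  have scale: "(\<lambda>x. N * x) \<in> PL" using affI[of 0 1] aff_subset_PL by simp
  have trans: "(\<lambda>x. x + (1 - 2 / N + 1 / N\<^sup>2)) \<in> PL" by (rule aff_subset_PL[OF aff_translation[OF s]])
  have idx: "(\<lambda>x. x) \<in> PL" using PL_id by (simp add: id_def)
  have g1: "(\<lambda>x. if x \<le> 1 then shrink x else x) \<in> PL" (is "?g1 \<in> _")
    by (rule PL_glue_at[OF shrink_PL idx]) (auto simp: shrink_def)
  have g2: "(\<lambda>x. if x \<le> 1 / N then x + (1 - 2 / N + 1 / N\<^sup>2) else ?g1 x) \<in> PL" (is "?g2 \<in> _")
    by (rule PL_glue_at[OF trans g1])
      (use N_ineqs in \<open>auto simp: shrink_def field_simps power2_eq_square\<close>)
  have g3: "(\<lambda>x. if x \<le> ?q then N * x else ?g2 x) \<in> PL" (is "?g3 \<in> _")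
    by (rule PL_glue_at[OF scale g2 b1])
      (use N_ineqs N_mult_break in simp)
  have "(\<lambda>x. if x \<le> 0 then x else ?g3 x) \<in> PL"
    by (rule PL_glue_at[OF idx g3]) (use N_ineqs(3) in auto)
  then show ?thesis unfolding shift_def[abs_def] .
qed

lemma shift_simps:
  shows shift_scale: "0 \<le> x \<Longrightarrow> x \<le> 1 / N - 1 / N\<^sup>2 \<Longrightarrow> shift x = N * x"
    and shift_translate: "1 / N - 1 / N\<^sup>2 \<le> x \<Longrightarrow> x \<le> 1 / N \<Longrightarrow> shift x = x + (1 - 2 / N + 1 / N\<^sup>2)"
    and shift_shrink: "1 / N \<le> x \<Longrightarrow> x \<le> 1 \<Longrightarrow> shift x = shrink x"
    and shift_outside: "x \<le> 0 \<or> 1 \<le> x \<Longrightarrow> shift x = x"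
proof -
  show "shift x = N * x" if "0 \<le> x" "x \<le> 1 / N - 1 / N\<^sup>2"
    using that by (auto simp: shift_def)
  show "shift x = x + (1 - 2 / N + 1 / N\<^sup>2)" if "1 / N - 1 / N\<^sup>2 \<le> x" "x \<le> 1 / N"
  proof (cases "x = 1 / N - 1 / N\<^sup>2")
    case True
    moreover have "0 < 1 / N - 1 / N\<^sup>2" using N_ineqs by linarith
    ultimately show ?thesis using N_mult_break by (simp add: shift_def)
  qed (use that N_ineqs in \<open>auto simp: shift_def\<close>)
  show "shift x = shrink x" if "1 / N \<le> x" "x \<le> 1"
  proof (cases "x = 1 / N")
    case True
    moreover have "shrink (1 / N) = 1 / N + (1 - 2 / N + 1 / N\<^sup>2)"
      by (simp add: shrink_def field_simps power2_eq_square)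
    moreover have "\<not> 1 / N \<le> 1 / N - 1 / N\<^sup>2" "\<not> 1 / N \<le> 0" using N_ineqs(1,4) by linarith+
    ultimately show ?thesis by (simp only: shift_def if_False order_refl if_True)
  next
    case False
    then have "\<not> x \<le> 0" "\<not> x \<le> 1 / N - 1 / N\<^sup>2" "\<not> x \<le> 1 / N"
      using that N_ineqs(1,4) by linarith+
    then show ?thesis using that by (simp only: shift_def if_False if_True)
  qed
  show "shift x = x" if "x \<le> 0 \<or> 1 \<le> x"
  proof (cases "x \<le> 0")
    case False
    then have "\<not> x \<le> 1 / N - 1 / N\<^sup>2" "\<not> x \<le> 1 / N" using that N_ineqs(2,4) by linarith+
    then show ?thesis using False that by (auto simp only: shift_def if_False) (simp add: shrink_def)
  qed (simp add: shift_def)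
qed

lemma shift_unit_homeos: "shift \<in> unit_homeos"
  using PL_strict_mono[OF shift_PL] PL_surj[OF shift_PL] shift_outside by (auto simp: unit_homeos_def)

lemma shrink_inverse: "shrink (N * x - (N - 1)) = x" "N * shrink x - (N - 1) = x"
  by (auto simp: shrink_def field_simps)

lemma double_shrink: "double (shrink x) = shrink (shift x)"
  by (simp add: double_def shrink_inverse)

lemma double_PL: "double \<in> PL"
proof -
  have "- (N - 1) \<in> Z" by (intro Z_uminus Z_diff) auto
  then have "(\<lambda>x. N powi 1 * x + - (N - 1)) \<in> PL" by (intro aff_subset_PL affI)
  then have "(\<lambda>x. N * x - (N - 1)) \<in> PL" by (simp add: algebra_simps)
  moreover have "double = shrink \<circ> (shift \<circ> (\<lambda>x. N * x - (N - 1)))"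
    by (auto simp: double_def)
  ultimately show ?thesis using PL_compose shrink_PL shift_PL by simp
qed

lemma double_below: "x \<le> 1 - 1 / N \<Longrightarrow> double x = x"
proof -
  assume "x \<le> 1 - 1 / N"
  then have "N * x - (N - 1) \<le> 0" by (simp add: field_simps)
  then show ?thesis by (simp add: double_def shift_outside shrink_inverse)
qed

lemma double_above: "1 \<le> x \<Longrightarrow> double x = x"
proof -
  assume "1 \<le> x"
  then have "N * 1 \<le> N * x" by (intro mult_left_mono) simp_all
  then have "1 \<le> N * x - (N - 1)" by simp
  then show ?thesis by (simp add: double_def shift_outside shrink_inverse)
qed

lemma double_unit_homeos: "double \<in> unit_homeos"
proof -
  have "double x = x" if "x \<le> 0 \<or> 1 \<le> x" for x
  proof (cases "1 \<le> x")
    case False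
    then have "x \<le> 1 - 1 / N" using that N_ineqs(2) by linarith
    then show ?thesis by (rule double_below)
  qed (rule double_above)
  then show ?thesis
    using PL_strict_mono[OF double_PL] PL_surj[OF double_PL] by (auto simp: unit_homeos_def)
qed

text \<open>The point \<open>n x\<close> lies in \<open>[0, 1]\<close>, where \<^term>\<open>spread \<psi>\<close> is trivial.\<close>

lemma conjugator_scale:
  assumes "\<psi> \<in> unit_homeos" "0 \<le> x" "x \<le> 1 / N"
  shows "conjugator \<psi> (N * x) = N * conjugator \<psi> x"
proof -
  have "expand \<psi> x = N * x"
    using spread_on[OF assms(1), of 0 "N * x"] assms(2,3) n_ge_3 by (simp add: expand_def field_simps)
  then show ?thesis using conjugator_expand[OF assms(1), of x] by simp
qed

text \<open>The point \<open>n (shrink x)\<close> lies in \<open>[n - 1, n]\<close>, where \<^term>\<open>spread \<psi>\<close> is trivial because \<open>n - 1 \<noteq> 1\<close>.\<close>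

lemma conjugator_shrink:
  assumes "\<psi> \<in> unit_homeos" "0 \<le> x" "x \<le> 1"
  shows "conjugator \<psi> (shrink x) = shrink (conjugator \<psi> x)"
proof -
  have "N * shrink x = x + of_int (n - 1)" by (simp add: shrink_def field_simps)
  moreover have "(n - 1) mod n = n - 1" by (rule mod_pos_pos_trivial) (use n_ge_3 in simp_all)
  ultimately have "expand \<psi> (shrink x) = x + of_int (n - 1)"
    using spread_on[OF assms(1), of "n - 1" "x + of_int (n - 1)"] assms(2,3) n_ge_3 by (simp add: expand_def)
  then have "N * conjugator \<psi> (shrink x) = conjugator \<psi> x + (N - 1)"
    using conjugator_expand[OF assms(1), of "shrink x"] conjugator_translate[OF assms(1), of x "n - 1"] by simp
  then show ?thesis by (simp add: shrink_def field_simps)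
qed

text \<open>On each of its pieces \<^term>\<open>shift\<close> is composed of scaling by \<open>n\<close>, \<^term>\<open>shrink\<close> and their inverses,
  all of which the conjugator respects; the break points are fixed by the conjugator.\<close>

lemma conjugator_shift:
  assumes "\<psi> \<in> unit_homeos" shows "conjugator \<psi> (shift x) = shift (conjugator \<psi> x)"
proof -
  let ?h = "conjugator \<psi>"
  note mono = conjugator_mono[OF assms]
  have h0: "?h 0 = 0" and h1: "?h 1 = 1" using conjugator_of_int[OF assms, of 0] conjugator_of_int[OF assms, of 1] by simp_all
  have hN: "?h (1 / N) = 1 / N"
    using conjugator_scale[OF assms, of "1 / N"] h1 by (simp add: field_simps)
  have shrink0: "shrink 0 = 1 - 1 / N" by (simp add: shrink_def)
  have "?h (1 - 1 / N) = 1 - 1 / N" using conjugator_shrink[OF assms, of 0] h0 by (simp add: shrink0)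
  moreover have "0 \<le> 1 / N - 1 / N\<^sup>2" "1 / N - 1 / N\<^sup>2 \<le> 1 / N" using N_ineqs by linarith+
  ultimately have "N * ?h (1 / N - 1 / N\<^sup>2) = N * (1 / N - 1 / N\<^sup>2)"
    using conjugator_scale[OF assms, of "1 / N - 1 / N\<^sup>2"] N_mult_break by simp
  then have hq: "?h (1 / N - 1 / N\<^sup>2) = 1 / N - 1 / N\<^sup>2" by simp
  consider "x \<le> 0 \<or> 1 \<le> x" | "0 \<le> x" "x \<le> 1 / N - 1 / N\<^sup>2"
    | "1 / N - 1 / N\<^sup>2 \<le> x" "x \<le> 1 / N" | "1 / N \<le> x" "x \<le> 1" by linarith
  then show ?thesis
  proof cases
    case 1
    then have "?h x \<le> 0 \<or> 1 \<le> ?h x" using mono[of x 0] mono[of 1 x] h0 h1 by auto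
    then show ?thesis using 1 by (simp add: shift_outside)
  next
    case 2
    then have "0 \<le> ?h x" "?h x \<le> 1 / N - 1 / N\<^sup>2" using mono[of 0 x] mono[of x "1 / N - 1 / N\<^sup>2"] h0 hq by auto
    moreover have "x \<le> 1 / N" using 2 N_ineqs by linarith
    ultimately show ?thesis using 2 conjugator_scale[OF assms, of x] by (simp add: shift_scale)
  next
    case 3
    \<comment> \<open>\<open>x\<close> has initial digits \<open>0\<close> and \<open>n - 1\<close>, followed by the digits of \<open>z\<close>\<close>
    define z where "z = N * (N * x) - (N - 1)"
    have z: "0 \<le> z" "z \<le> 1" "x = shrink z / N"
      using 3 by (auto simp: z_def shrink_def field_simps power2_eq_square)
    have hx: "?h x = shrink (?h z) / N"
    proof -
      have "0 \<le> x" using 3(1) N_ineqs by linarith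
      then have "?h (N * x) = N * ?h x" using conjugator_scale[OF assms] 3(2) by blast
      moreover have "N * x = shrink z" using z(3) by simp
      ultimately show ?thesis using conjugator_shrink[OF assms z(1,2)] by (simp add: field_simps)
    qed
    have b: "1 / N - 1 / N\<^sup>2 \<le> ?h x" "?h x \<le> 1 / N" using mono[of x "1 / N"] mono[of "1 / N - 1 / N\<^sup>2" x] 3 hN hq by auto
    have sh: "shrink w / N + (1 - 2 / N + 1 / N\<^sup>2) = shrink (w / N)" for w
      by (simp add: shrink_def field_simps power2_eq_square)
    have "?h (z / N) = ?h z / N" using conjugator_scale[OF assms, of "z / N"] z by (simp add: field_simps)
    moreover have "shift x = shrink (z / N)" using shift_translate[OF 3] z(3) sh by simp
    moreover have "shift (?h x) = shrink (?h z / N)" using shift_translate[OF b] hx sh by simp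
    moreover have "0 \<le> z / N" "z / N \<le> 1" using z N_ge_2 by (auto simp: field_simps)
    ultimately show ?thesis using conjugator_shrink[OF assms, of "z / N"] by simp
  next
    case 4
    then have "1 / N \<le> ?h x" "?h x \<le> 1" using mono[of x 1] mono[of "1 / N" x] h1 hN by auto
    moreover have "0 \<le> x" using 4 N_ineqs by linarith
    ultimately show ?thesis using 4 conjugator_shrink[OF assms, of x] by (simp add: shift_shrink)
  qed
qed

lemma shift_central: "shift \<in> central"
  using shift_unit_homeos conjugator_shift by (auto simp: central_def)

lemma conjugator_double:
  assumes "\<psi> \<in> unit_homeos" shows "conjugator \<psi> (double x) = double (conjugator \<psi> x)"
proof -
  let ?h = "conjugator \<psi>"
  note mono = conjugator_mono[OF assms]
  have h0: "?h 0 = 0" and h1: "?h 1 = 1" using conjugator_of_int[OF assms, of 0] conjugator_of_int[OF assms, of 1] by simp_all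
  have shrink0: "shrink 0 = 1 - 1 / N" by (simp add: shrink_def)
  have ha: "?h (1 - 1 / N) = 1 - 1 / N" using conjugator_shrink[OF assms, of 0] h0 by (simp add: shrink0)
  consider "x \<le> 1 - 1 / N" | "1 \<le> x" | "1 - 1 / N \<le> x" "x \<le> 1" by linarith
  then show ?thesis
  proof cases
    case 1
    then show ?thesis using mono[of x "1 - 1 / N"] ha by (simp add: double_below)
  next
    case 2
    then show ?thesis using mono[of 1 x] h1 by (simp add: double_above)
  next
    case 3
    define z where "z = N * x - (N - 1)"
    have z: "0 \<le> z" "z \<le> 1" "x = shrink z"
      using 3 by (auto simp: z_def shrink_def field_simps)
    have "0 \<le> shift z" "shift z \<le> 1"
      using z unit_homeos_bounds[OF shift_unit_homeos, of z] shift_outside[of 0] shift_outside[of 1]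
      by (cases "z = 0"; cases "z = 1"; simp)+
    then show ?thesis
      using z conjugator_shrink[OF assms] conjugator_shift[OF assms] by (simp add: double_shrink)
  qed
qed

lemma double_central: "double \<in> central"
  using double_unit_homeos conjugator_double by (auto simp: central_def)

section \<open>An equivariant embedding of the line in a Cantor set\<close>

text \<open>For \<open>x\<close> in \<open>[0, 1)\<close> with binary digits \<open>d\<^sub>k\<close>, \<open>digits x\<close> is \<open>\<Sum>k\<ge>1. (n - 1) d\<^sub>k / n\<^sup>k\<close>. Summation by
  parts, with \<open>d\<^sub>k = \<lfloor>2 ^ k x\<rfloor> - 2 \<lfloor>2 ^ (k - 1) x\<rfloor>\<close>, gives the form used here, which is visibly increasing
  in \<open>x\<close>. It converges because \<open>n > 2\<close>.\<close>

definition digit_sum :: "real \<Rightarrow> real" where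
  "digit_sum x = (\<Sum>k. of_int \<lfloor>2 ^ k * x\<rfloor> / N ^ k)"

definition digits :: "real \<Rightarrow> real" where
  "digits x = (N - 1) * (N - 2) / N * digit_sum x"

lemma summable_geometric_2: "summable (\<lambda>k. (2 / N) ^ k)"
  using N_ge_3 by (intro summable_geometric) simp

lemma summable_digit_sum:
  fixes x :: real
  shows "summable (\<lambda>k. of_int \<lfloor>2 ^ k * x\<rfloor> / N ^ k)"
proof (rule summable_comparison_test')
  show "summable (\<lambda>k. (\<bar>x\<bar> + 1) * (2 / N) ^ k)" by (intro summable_mult summable_geometric_2)
  fix k :: nat
  have "\<bar>of_int \<lfloor>2 ^ k * x\<rfloor>\<bar> \<le> \<bar>2 ^ k * x\<bar> + (1::real)" by linarith
  also have "\<dots> = 2 ^ k * \<bar>x\<bar> + 1" by (simp add: abs_mult)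
  also have "\<dots> \<le> 2 ^ k * \<bar>x\<bar> + 2 ^ k" by simp
  finally have "\<bar>of_int \<lfloor>2 ^ k * x\<rfloor>\<bar> \<le> (\<bar>x\<bar> + 1) * 2 ^ k" by (simp add: algebra_simps)
  then show "norm (of_int \<lfloor>2 ^ k * x\<rfloor> / N ^ k) \<le> (\<bar>x\<bar> + 1) * (2 / N) ^ k"
    by (simp add: abs_divide power_divide divide_right_mono)
qed

lemma digit_sum_add_1: "digit_sum (x + 1) = digit_sum x + N / (N - 2)"
proof -
  have "(of_int \<lfloor>2 ^ k * (x + 1)\<rfloor> :: real) = of_int \<lfloor>2 ^ k * x\<rfloor> + 2 ^ k" for k
    using floor_add_int[of "2 ^ k * x" "2 ^ k"] by (simp add: algebra_simps)
  then have "digit_sum (x + 1) = (\<Sum>k. of_int \<lfloor>2 ^ k * x\<rfloor> / N ^ k + (2 / N) ^ k)"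
    by (simp add: digit_sum_def add_divide_distrib power_divide)
  also have "\<dots> = digit_sum x + (\<Sum>k. (2 / N) ^ k)"
    unfolding digit_sum_def by (rule suminf_add[symmetric, OF summable_digit_sum summable_geometric_2])
  also have "(\<Sum>k. (2 / N) ^ k) = 1 / (1 - 2 / N)"
    using N_ge_3 by (intro suminf_geometric) simp
  also have "\<dots> = N / (N - 2)" using N_ge_3 by (simp add: field_simps)
  finally show ?thesis .
qed

lemma digit_sum_double: "digit_sum (2 * x) = N * (digit_sum x - of_int \<lfloor>x\<rfloor>)"
proof -
  have "(\<Sum>k. of_int \<lfloor>2 ^ Suc k * x\<rfloor> / N ^ Suc k) = digit_sum x - of_int \<lfloor>x\<rfloor>"
    using suminf_split_head[OF summable_digit_sum[of x]] by (simp add: digit_sum_def)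
  moreover have "N * (\<Sum>k. of_int \<lfloor>2 ^ Suc k * x\<rfloor> / N ^ Suc k) = (\<Sum>k. N * (of_int \<lfloor>2 ^ Suc k * x\<rfloor> / N ^ Suc k))"
    by (intro suminf_mult[symmetric]) (rule summable_Suc_iff[THEN iffD2, OF summable_digit_sum])
  moreover have "N * (of_int \<lfloor>2 ^ Suc k * x\<rfloor> / N ^ Suc k) = of_int \<lfloor>2 ^ k * (2 * x)\<rfloor> / N ^ k" for k
    by (simp add: mult.assoc mult.left_commute)
  ultimately show ?thesis by (simp add: digit_sum_def)
qed

lemma digit_sum_strict_mono: "x < y \<Longrightarrow> digit_sum x < digit_sum y"
proof -
  assume "x < y"
  obtain K :: nat where K: "1 / (y - x) < 2 ^ K" using real_arch_pow[of 2 "1 / (y - x)"] by auto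
  then have "1 < 2 ^ K * y - 2 ^ K * x" using \<open>x < y\<close> by (simp add: field_simps)
  then have "\<lfloor>2 ^ K * x\<rfloor> < \<lfloor>2 ^ K * y\<rfloor>" by linarith
  let ?d = "\<lambda>k. of_int \<lfloor>2 ^ k * y\<rfloor> / N ^ k - of_int \<lfloor>2 ^ k * x\<rfloor> / N ^ k"
  have "0 < suminf ?d"
  proof (rule suminf_pos2)
    show "summable ?d" by (intro summable_diff summable_digit_sum)
    show "0 < ?d K" using \<open>\<lfloor>2 ^ K * x\<rfloor> < \<lfloor>2 ^ K * y\<rfloor>\<close> by (simp add: divide_strict_right_mono)
    fix k
    have "\<lfloor>2 ^ k * x\<rfloor> \<le> \<lfloor>2 ^ k * y\<rfloor>" using \<open>x < y\<close> by (intro floor_mono) simp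
    then show "0 \<le> ?d k" by (simp add: divide_right_mono)
  qed
  also have "suminf ?d = digit_sum y - digit_sum x"
    unfolding digit_sum_def by (rule suminf_diff[symmetric, OF summable_digit_sum summable_digit_sum])
  finally show ?thesis by simp
qed

lemma digits_strict_mono: "strict_mono digits"
proof (rule strict_monoI)
  fix x y :: real assume "x < y"
  then show "digits x < digits y"
    unfolding digits_def using digit_sum_strict_mono N_ge_3
    by (intro mult_strict_left_mono divide_pos_pos mult_pos_pos) auto
qed

lemma digits_add_1: "digits (x + 1) = digits x + (N - 1)"
proof -
  have "(N - 1) * (N - 2) / N * (N / (N - 2)) = N - 1" using N_ge_3 by simp
  then show ?thesis by (simp only: digits_def digit_sum_add_1 distrib_left)
qed

lemma digits_0 [simp]: "digits 0 = 0"
  by (simp add: digits_def digit_sum_def)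

lemma digits_1 [simp]: "digits 1 = N - 1"
  using digits_add_1[of 0] by simp

lemma digits_low: "0 \<le> x \<Longrightarrow> x < 1 \<Longrightarrow> digits (2 * x) = N * digits x"
proof -
  assume "0 \<le> x" "x < 1"
  then have "\<lfloor>x\<rfloor> = 0" by linarith
  then show ?thesis by (simp add: digits_def digit_sum_double)
qed

lemma digits_high: "0 \<le> x \<Longrightarrow> x < 1 \<Longrightarrow> digits x = shrink (digits (2 * x - 1))"
  using digits_low[of x] digits_add_1[of "2 * x - 1"] by (simp add: shrink_def field_simps)

lemma digits_inverse_power: "digits ((1 / 2) ^ k) = (N - 1) / N ^ k"
proof (induction k)
  case (Suc k)
  have "(1 / 2 :: real) ^ Suc k < 1" by (rule power_Suc_less_one) auto
  then have "digits (2 * (1 / 2) ^ Suc k) = N * digits ((1 / 2) ^ Suc k)" by (intro digits_low) auto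
  then show ?case using Suc by (simp add: field_simps)
qed simp

lemma digits_one_minus: "digits (1 - (1 / 2) ^ k) = 1 - 1 / N ^ k"
proof (induction k)
  case (Suc k)
  have "(1 / 2 :: real) ^ Suc k < 1" by (rule power_Suc_less_one) auto
  then have "digits (1 - (1 / 2) ^ Suc k) = shrink (digits (2 * (1 - (1 / 2) ^ Suc k) - 1))"
    by (intro digits_high) auto
  also have "2 * (1 - (1 / 2) ^ Suc k) - 1 = (1 - (1 / 2) ^ k :: real)" by simp
  finally show ?case using Suc by (simp add: shrink_def)
qed simp

text \<open>Monotonicity alone only gives the upper bound \<open>n - 1\<close>, the value at 1; the bound 1 is the limit of the
  values at \<open>1 - (1 / 2) ^ k\<close>.\<close>

lemma digits_bounds:
  assumes "0 \<le> x" "x < 1" shows "0 \<le> digits x" "digits x < 1"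
proof -
  show "0 \<le> digits x" using digits_strict_mono assms(1) by (metis digits_0 strict_mono_less_eq)
  obtain k where "(1 / 2) ^ k < 1 - x" using real_arch_pow_inv[of "1 - x" "1 / 2"] assms(2) by auto
  then have "digits x < digits (1 - (1 / 2) ^ k)" using digits_strict_mono by (simp add: strict_mono_less)
  also have "\<dots> \<le> 1" by (simp add: digits_one_minus)
  finally show "digits x < 1" .
qed

text \<open>The unit intervals of the line go to the end-digit intervals \<open>\<dots>, 00e, 0e, e0, ee0, \<dots>\<close> of \<open>[0, 1]\<close>
  (with \<open>e = n - 1\<close>), which \<^term>\<open>shift\<close> moves one step to the right, and inside a unit interval
  binary digits become n-ary ones.\<close>

definition cantor :: "real \<Rightarrow> real" where
  "cantor x = (if 0 \<le> x then (shrink ^^ Suc (nat \<lfloor>x\<rfloor>)) (digits (frac x) / N)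
     else shrink (digits (frac x)) / N ^ nat (- \<lfloor>x\<rfloor>))"

lemma shrink_strict_mono: "shrink x < shrink y \<longleftrightarrow> x < y"
  by (simp add: shrink_def divide_less_cancel)

lemma shrink_bounds: "0 \<le> x \<Longrightarrow> 1 - 1 / N \<le> shrink x" "x < 1 \<Longrightarrow> shrink x < 1" "x \<le> 1 \<Longrightarrow> shrink x \<le> 1"
  by (auto simp: shrink_def divide_right_mono divide_le_cancel)

lemma shrink_pow_bounds:
  assumes "0 \<le> x" "x < 1" shows "0 \<le> (shrink ^^ k) x" "(shrink ^^ k) x < 1"
proof (induction k)
  case (Suc k)
  have ge0: "0 \<le> 1 - 1 / N" using N_ineqs by linarith
  {
    case 1 then show ?case
      using order_trans[OF ge0 shrink_bounds(1)[OF Suc(1)]] by simp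
  next
    case 2 then show ?case using Suc(2) shrink_bounds(2)[of "(shrink ^^ k) x"] by simp
  }
qed (use assms in auto)

lemma frac_digits: "0 \<le> digits (frac x)" "digits (frac x) < 1" "0 \<le> digits (frac x) / N" "digits (frac x) / N < 1 / N"
  using digits_bounds[of "frac x"] frac_lt_1[of x] by (auto simp: divide_strict_right_mono)

lemma shift_middle: "0 \<le> w \<Longrightarrow> w \<le> 1 \<Longrightarrow> shift (shrink w / N) = shrink (w / N)"
proof -
  assume w: "0 \<le> w" "w \<le> 1"
  have "1 / N - 1 / N\<^sup>2 = (1 - 1 / N) / N" by (simp add: field_simps power2_eq_square)
  then have "1 / N - 1 / N\<^sup>2 \<le> shrink w / N" "shrink w / N \<le> 1 / N"
    using shrink_bounds(1)[of w] shrink_bounds(3)[of w] w by (auto simp: divide_right_mono)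
  moreover have "shrink w / N + (1 - 2 / N + 1 / N\<^sup>2) = shrink (w / N)"
    by (simp add: shrink_def field_simps power2_eq_square)
  ultimately show ?thesis using shift_translate by simp
qed

lemma cantor_nonneg_bounds:
  assumes "0 \<le> x" shows "1 - 1 / N \<le> cantor x" "cantor x < 1"
proof -
  have "digits (frac x) / N < 1" using frac_digits(4)[of x] N_ineqs by linarith
  then show "1 - 1 / N \<le> cantor x" "cantor x < 1"
    using assms shrink_pow_bounds[OF frac_digits(3), of x] shrink_bounds by (simp_all add: cantor_def)
qed

lemma cantor_neg_bounds:
  assumes "x < 0" shows "0 < cantor x" "cantor x < 1 / N"
proof -
  have s: "0 < shrink (digits (frac x))" "shrink (digits (frac x)) < 1"
    using shrink_bounds[of "digits (frac x)"] frac_digits[of x] N_ineqs by linarith+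
  show "0 < cantor x" using assms s by (simp add: cantor_def)
  have "1 \<le> nat (- \<lfloor>x\<rfloor>)" using assms by linarith
  then have "N ^ 1 \<le> N ^ nat (- \<lfloor>x\<rfloor>)" using N_ge_3 by (intro power_increasing) auto
  then have "1 / N ^ nat (- \<lfloor>x\<rfloor>) \<le> 1 / N" by (intro divide_left_mono) auto
  moreover have "cantor x < 1 / N ^ nat (- \<lfloor>x\<rfloor>)" using assms s by (simp add: cantor_def divide_strict_right_mono)
  ultimately show "cantor x < 1 / N" by linarith
qed

lemma cantor_bounds: "0 < cantor x" "cantor x < 1"
  using cantor_nonneg_bounds[of x] cantor_neg_bounds[of x] N_ineqs by (cases "0 \<le> x"; linarith)+

lemma cantor_shift: "cantor (x + 1) = shift (cantor x)"
proof -
  have fr: "frac (x + 1) = frac x" by (simp add: frac_def)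
  have fl: "\<lfloor>x + 1\<rfloor> = \<lfloor>x\<rfloor> + 1" by simp
  consider "0 \<le> x" | "-1 \<le> x" "x < 0" | "x < -1" by linarith
  then show ?thesis
  proof cases
    case 1
    then have "nat \<lfloor>x + 1\<rfloor> = Suc (nat \<lfloor>x\<rfloor>)" by (simp add: nat_add_distrib)
    then have "cantor (x + 1) = shrink (cantor x)" using 1 fr by (simp add: cantor_def)
    moreover have "1 / N \<le> cantor x" "cantor x \<le> 1" using cantor_nonneg_bounds[OF 1] N_ineqs by linarith+
    ultimately show ?thesis by (simp add: shift_shrink)
  next
    case 2
    then have "\<lfloor>x\<rfloor> = -1" by linarith
    then have "cantor (x + 1) = shrink (digits (frac x) / N)" "cantor x = shrink (digits (frac x)) / N"
      using 2 fr fl by (simp_all add: cantor_def)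
    then show ?thesis using shift_middle frac_digits[of x] by simp
  next
    case 3
    define m where "m = nat (- \<lfloor>x + 1\<rfloor>)"
    have m: "nat (- \<lfloor>x\<rfloor>) = Suc m" using 3 by (simp add: m_def) linarith
    have 4: "cantor (x + 1) = shrink (digits (frac x)) / N ^ m" "cantor x = shrink (digits (frac x)) / N ^ Suc m"
      using 3 fr m by (simp_all add: cantor_def m_def)
    then have 5: "cantor (x + 1) = N * cantor x" by simp
    have "cantor (x + 1) < 1 / N" using 3 by (intro cantor_neg_bounds) simp
    then have "cantor x < 1 / N\<^sup>2" using 5 by (simp add: field_simps power2_eq_square)
    then have "0 \<le> cantor x" "cantor x \<le> 1 / N - 1 / N\<^sup>2" using cantor_bounds(1)[of x] N_ineqs by linarith+
    then show ?thesis using 5 by (simp add: shift_scale)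
  qed
qed

lemma cantor_unit_interval: "0 \<le> x \<Longrightarrow> x < 1 \<Longrightarrow> cantor x = shrink (digits x / N)"
proof -
  assume "0 \<le> x" "x < 1"
  then have "\<lfloor>x\<rfloor> = 0" by linarith
  then show ?thesis using \<open>0 \<le> x\<close> by (simp add: cantor_def frac_def)
qed

text \<open>For \<open>x \<ge> 1\<close> this reduces to \<open>cantor_shift\<close>, because there \<^term>\<open>cantor\<close> also intertwines the unit
  translation with \<^term>\<open>shrink\<close>; on the two halves of \<open>[0, 1)\<close> it is the recursion for \<^term>\<open>digits\<close>.\<close>

lemma cantor_double: "cantor (g_gen 0 x) = double (cantor x)"
proof -
  consider "x < 0" | "0 \<le> x" "x < 1 / 2" | "1 / 2 \<le> x" "x < 1" | "1 \<le> x" by linarith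
  then show ?thesis
  proof cases
    case 1
    then have "cantor x \<le> 1 - 1 / N" using cantor_neg_bounds[OF 1] N_ineqs by linarith
    then show ?thesis using 1 by (simp add: g_gen_def double_below)
  next
    case 2
    have d: "digits (2 * x) = N * digits x" using 2 by (intro digits_low) auto
    have "digits (2 * x) < digits 1" using 2 by (intro strict_monoD[OF digits_strict_mono]) simp
    then have "N * digits x < N - 1" using d by simp
    then have "digits x / N \<le> 1 / N - 1 / N\<^sup>2" by (simp add: field_simps power2_eq_square)
    moreover have "0 \<le> digits x / N" using digits_bounds(1)[of x] 2 by simp
    ultimately have "shift (digits x / N) = digits (2 * x) / N" using d by (simp add: shift_scale)
    moreover have "cantor x = shrink (digits x / N)" "cantor (2 * x) = shrink (digits (2 * x) / N)"
      using 2 cantor_unit_interval by auto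
    ultimately show ?thesis using 2 by (simp add: g_gen_def double_shrink)
  next
    case 3
    have x: "0 \<le> 2 * x - 1" "2 * x - 1 < 1" using 3 by auto
    have "cantor x = shrink (shrink (digits (2 * x - 1)) / N)"
      using 3 cantor_unit_interval[of x] digits_high[of x] by simp
    then have "double (cantor x) = shrink (shrink (digits (2 * x - 1) / N))"
      using digits_bounds[OF x] by (simp add: double_shrink shift_middle)
    moreover have "\<lfloor>2 * x\<rfloor> = 1" using x by linarith
    then have "cantor (2 * x) = shrink (shrink (digits (2 * x - 1) / N))"
      using 3 by (simp add: cantor_def frac_def)
    ultimately show ?thesis using 3 by (simp add: g_gen_def)
  next
    case 4
    have e: "cantor (y + 1) = shrink (cantor y)" if "0 \<le> y" for y
    proof -
      have "nat \<lfloor>y + 1\<rfloor> = Suc (nat \<lfloor>y\<rfloor>)" using that by (simp add: nat_add_distrib)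
      moreover have "frac (y + 1) = frac y" by (simp add: frac_def)
      ultimately show ?thesis using that by (simp add: cantor_def)
    qed
    have "g_gen 0 x = x + 1" using 4 by (simp add: g_gen_def)
    then have "cantor (g_gen 0 x) = shrink (cantor x)" using e 4 by simp
    also have "cantor x = shift (cantor (x - 1))" using cantor_shift[of "x - 1"] by simp
    also have "shrink (shift (cantor (x - 1))) = double (cantor (x - 1 + 1))"
      using e[of "x - 1"] 4 by (simp add: double_shrink)
    finally show ?thesis by simp
  qed
qed

text \<open>For nonnegative arguments this is read off the definition; the general case is moved there by a power
  of \<^term>\<open>shift\<close>.\<close>

lemma cantor_strict_mono: "strict_mono cantor"
proof (rule strict_monoI)
  have nonneg: "cantor x < cantor y" if "0 \<le> x" "x < y" for x y
  proof -
    have pow_mono: "(shrink ^^ k) a < (shrink ^^ k) b" if "a < b" for k a b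
      using that by (induction k) (auto simp: shrink_strict_mono)
    define k j where "k = nat \<lfloor>x\<rfloor>" and "j = nat \<lfloor>y\<rfloor> - nat \<lfloor>x\<rfloor>"
    have "\<lfloor>x\<rfloor> \<le> \<lfloor>y\<rfloor>" using that by (intro floor_mono) simp
    then have kj: "nat \<lfloor>y\<rfloor> = k + j" using that by (simp add: k_def j_def)
    have "cantor y = (shrink ^^ (Suc k + j)) (digits (frac y) / N)" "cantor x = (shrink ^^ Suc k) (digits (frac x) / N)"
      using that kj by (simp_all add: cantor_def k_def)
    then have e: "cantor y = (shrink ^^ Suc k) ((shrink ^^ j) (digits (frac y) / N))" "cantor x = (shrink ^^ Suc k) (digits (frac x) / N)"
      by (simp_all add: funpow_add)
    have "digits (frac x) / N < (shrink ^^ j) (digits (frac y) / N)"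
    proof (cases j)
      case 0
      moreover have "0 \<le> \<lfloor>x\<rfloor>" "0 \<le> \<lfloor>y\<rfloor>" using that by simp_all
      ultimately have "\<lfloor>x\<rfloor> = \<lfloor>y\<rfloor>" using kj by (simp add: k_def eq_nat_nat_iff)
      then have "frac x < frac y" using that by (simp add: frac_def)
      then show ?thesis using 0 digits_strict_mono by (simp add: strict_mono_less divide_strict_right_mono)
    next
      case (Suc i)
      have "digits (frac y) / N < 1" using frac_digits(4)[of y] N_ineqs by linarith
      then have "1 - 1 / N \<le> (shrink ^^ j) (digits (frac y) / N)"
        using Suc shrink_bounds(1) shrink_pow_bounds(1)[OF frac_digits(3)] by simp
      then show ?thesis using frac_digits(4)[of x] N_ineqs by linarith
    qed
    then show ?thesis unfolding e by (rule pow_mono)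
  qed
  fix x y :: real assume "x < y"
  obtain j :: nat where j: "- x \<le> of_nat j" using real_arch_simple by blast
  have shift: "cantor (z + of_nat i) = (shift ^^ i) (cantor z)" for z and i :: nat
  proof (induction i)
    case (Suc i)
    have "cantor (z + of_nat (Suc i)) = cantor ((z + of_nat i) + 1)" by (simp add: ac_simps)
    then show ?case using cantor_shift[of "z + of_nat i"] Suc by simp
  qed simp
  have "(shift ^^ j) (cantor x) < (shift ^^ j) (cantor y)"
    using nonneg[of "x + of_nat j" "y + of_nat j"] j \<open>x < y\<close> by (simp flip: shift)
  moreover have "(shift ^^ j) a < (shift ^^ j) b \<longleftrightarrow> a < b" for a b
    by (induction j) (auto simp: unit_homeos_less_iff[OF shift_unit_homeos])
  ultimately show "cantor x < cantor y" by simp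
qed

lemma cantor_of_nat: "cantor (of_nat k) = 1 - 1 / N ^ Suc k"
proof -
  have "(shrink ^^ i) 0 = 1 - 1 / N ^ i" for i
    by (induction i) (auto simp: shrink_def)
  moreover have "cantor (of_nat k) = (shrink ^^ Suc k) 0" by (simp add: cantor_def frac_def)
  ultimately show ?thesis by metis
qed

lemma cantor_dense_ends:
  assumes "0 < y" "y < 1" obtains a b where "cantor a < y" "y < cantor b"
proof -
  have l: "cantor (- of_nat (Suc k)) < 1 / N ^ k" for k
  proof (induction k)
    case 0
    show ?case using cantor_bounds by simp
  next
    case (Suc k)
    have "cantor (- of_nat (Suc (Suc k)) + 1) = N * cantor (- of_nat (Suc (Suc k)))"
    proof -
      define z :: real where "z = - of_nat (Suc (Suc k))"
      have "z = of_int (- int (Suc (Suc k)))" "z + 1 = of_int (- int (Suc k))" by (simp_all add: z_def)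
      then have "nat (- \<lfloor>z\<rfloor>) = Suc (Suc k)" "nat (- \<lfloor>z + 1\<rfloor>) = Suc k"
        by (simp_all only: floor_of_int minus_minus nat_int)
      moreover have "frac (z + 1) = frac z" by (simp add: frac_def)
      moreover have "z < 0" "z + 1 < 0" by (simp_all add: z_def)
      ultimately show ?thesis unfolding z_def[symmetric] by (simp add: cantor_def)
    qed
    then have "N * cantor (- of_nat (Suc (Suc k))) < 1 / N ^ k" using Suc by simp
    then show ?case by (simp add: field_simps)
  qed
  obtain i where i: "(1 / N) ^ i < y" using real_arch_pow_inv[of y "1 / N"] assms(1) N_ineqs by auto
  obtain j where j: "(1 / N) ^ j < 1 - y" using real_arch_pow_inv[of "1 - y" "1 / N"] assms(2) N_ineqs by auto
  have "(1 / N) ^ Suc j \<le> (1 / N) ^ j" using N_ineqs by (intro power_decreasing) auto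
  then have "y < cantor (of_nat j)" using j unfolding cantor_of_nat by (simp add: power_one_over del: power_Suc)
  moreover have "cantor (- of_nat (Suc i)) < y" using l[of i] i by (simp add: power_one_over)
  ultimately show ?thesis using that by blast
qed

section \<open>The copy of F on the unit interval\<close>

text \<open>The interval between the one-sided limits of \<^term>\<open>cantor\<close> at \<open>x\<close>, described by inequalities so that
  equivariant increasing bijections visibly permute the gaps.\<close>

definition gap :: "real \<Rightarrow> real set" where
  "gap x = {y. (\<forall>x'<x. cantor x' \<le> y) \<and> (\<forall>x'>x. y \<le> cantor x')}"

lemma gap_bounds: "y \<in> gap x \<Longrightarrow> 0 < y \<and> y < 1"
proof -
  assume y: "y \<in> gap x"
  then have "cantor (x - 1) \<le> y" "y \<le> cantor (x + 1)" by (simp_all add: gap_def)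
  then show ?thesis using cantor_bounds(1)[of "x - 1"] cantor_bounds(2)[of "x + 1"] by linarith
qed

lemma gaps_cover:
  assumes "0 < y" "y < 1" obtains x where "y \<in> gap x"
proof -
  obtain a b where ab: "cantor a < y" "y < cantor b" using cantor_dense_ends[OF assms] .
  let ?S = "{x. cantor x < y}"
  have bdd: "bdd_above ?S"
  proof (rule bdd_aboveI)
    fix x assume "x \<in> ?S"
    then have "cantor x < cantor b" using ab by simp
    then show "x \<le> b" using cantor_strict_mono by (simp add: strict_mono_less)
  qed
  have "y \<in> gap (Sup ?S)"
    unfolding gap_def
  proof (intro CollectI conjI allI impI)
    fix x assume "x < Sup ?S"
    then obtain z where z: "cantor z < y" "x < z" using less_cSup_iff[OF _ bdd] ab(1) by auto
    then show "cantor x \<le> y" using strict_monoD[OF cantor_strict_mono, of x z] by simp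
  next
    fix x assume "x > Sup ?S"
    then have "x \<notin> ?S" using cSup_upper[OF _ bdd] by force
    then show "y \<le> cantor x" by simp
  qed
  then show ?thesis by (rule that)
qed

text \<open>The interior of a gap contains at most one value of \<^term>\<open>cantor\<close>, so it contains no limit point of
  values. Applied to break points, this shows that breaks do not cut gaps.\<close>

lemma limit_not_inside_gap:
  assumes b: "b islimpt range cantor" and y: "y \<in> gap x" "z \<in> gap x" and "y < b" "b < z"
  shows False
proof -
  have only: "v = x" if "y < cantor v" "cantor v < z" for v
  proof (rule ccontr)
    assume "v \<noteq> x"
    then consider "v < x" | "v > x" by linarith
    then show False using that y by cases (force simp: gap_def)+
  qed
  have "{y<..<z} \<inter> range cantor \<subseteq> {cantor x}" using only by auto
  then have "finite ({y<..<z} \<inter> range cantor)" by (rule finite_subset) simp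
  moreover have "b \<in> {y<..<z}" "open {y<..<z}" using assms by auto
  ultimately show False using b by (meson islimpt_eq_acc_point)
qed

lemma gap_side:
  assumes "b islimpt range cantor"
  shows "(\<forall>y\<in>gap x. y \<le> b) \<or> (\<forall>y\<in>gap x. b \<le> y)"
  using limit_not_inside_gap[OF assms] by (meson not_le)

lemma limit_image:
  assumes "y islimpt range cantor" "inj \<phi>" "isCont \<phi> y" "\<And>x. \<phi> (cantor x) = cantor (f x)"
  shows "\<phi> y islimpt range cantor"
proof -
  obtain s where s: "\<And>i. s i \<in> range cantor - {y}" "s \<longlonglongrightarrow> y"
    using assms(1) unfolding islimpt_sequential by blast
  have "\<phi> (s i) \<in> range cantor - {\<phi> y}" for i
    using s(1)[of i] assms(2,4) by (auto dest: injD)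
  moreover have "(\<lambda>i. \<phi> (s i)) \<longlonglongrightarrow> \<phi> y" using isCont_tendsto_compose[OF assms(3) s(2)] .
  ultimately show ?thesis unfolding islimpt_sequential by (intro exI[of _ "\<lambda>i. \<phi> (s i)"]) auto
qed

text \<open>The homeomorphism \<open>\<phi>\<close> of the unit interval is the n-adic copy of \<open>f\<close>. Affinity on gaps makes \<open>\<phi>\<close> unique,
  equivariance makes \<open>f\<close> unique, and the memberships are what the conjugator of \<open>\<phi>\<close> needs in order to
  normalize \<open>A\<^sub>n\<close>.\<close>

definition inflates :: "(real \<Rightarrow> real) \<Rightarrow> (real \<Rightarrow> real) \<Rightarrow> bool" where
  "inflates f \<phi> \<longleftrightarrow> strict_mono f \<and> surj f \<and> \<phi> \<in> central \<and> \<phi> \<in> PL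
     \<and> (\<forall>x. \<phi> (cantor x) = cantor (f x))
     \<and> (\<forall>x. \<exists>m c. \<forall>y\<in>gap x. \<phi> y = m * y + c)"

lemma inflates_bij: "inflates f \<phi> \<Longrightarrow> bij f" "inflates f \<phi> \<Longrightarrow> bij \<phi>"
  unfolding inflates_def using strict_mono_surj_bij PL_bij by blast+

lemma inflates_gap:
  assumes "inflates f \<phi>" shows "\<phi> y \<in> gap (f x) \<longleftrightarrow> y \<in> gap x"
proof -
  have f: "strict_mono f" "surj f" and \<phi>: "strict_mono \<phi>" and e: "\<And>x. cantor (f x) = \<phi> (cantor x)"
    using assms PL_strict_mono by (auto simp: inflates_def)
  have "\<phi> y \<in> gap (f x) \<longleftrightarrow> (\<forall>v. f v < f x \<longrightarrow> cantor (f v) \<le> \<phi> y) \<and> (\<forall>v. f v > f x \<longrightarrow> \<phi> y \<le> cantor (f v))"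
    unfolding gap_def using f(2) by (smt (verit) mem_Collect_eq surjD)
  then show ?thesis
    using f(1) \<phi> by (simp add: gap_def e strict_mono_less strict_mono_less_eq)
qed

lemma inflates_id: "inflates id id"
  by (auto simp: inflates_def strict_mono_def central_id PL_id intro: exI[of _ 1] exI[of _ 0])

lemma inflates_compose:
  assumes "inflates f \<phi>" "inflates g \<psi>" shows "inflates (f \<circ> g) (\<phi> \<circ> \<psi>)"
proof -
  have "\<exists>m c. \<forall>y\<in>gap x. (\<phi> \<circ> \<psi>) y = m * y + c" for x
  proof -
    obtain m c where 1: "\<forall>y\<in>gap x. \<psi> y = m * y + c" using assms(2) unfolding inflates_def by blast
    obtain l d where 2: "\<forall>y\<in>gap (g x). \<phi> y = l * y + d" using assms(1) unfolding inflates_def by blast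
    have "(\<phi> \<circ> \<psi>) y = (l * m) * y + (l * c + d)" if "y \<in> gap x" for y
    proof -
      have "\<psi> y \<in> gap (g x)" using inflates_gap[OF assms(2)] that by blast
      then show ?thesis using 1 2 that by (simp add: algebra_simps)
    qed
    then show ?thesis by blast
  qed
  then show ?thesis
    using assms strict_mono_surj_compose[of f g] central_compose PL_compose
    unfolding inflates_def by simp
qed

lemma inflates_inverse:
  assumes "inflates f \<phi>" shows "inflates (finv f) (finv \<phi>)"
proof -
  have f: "strict_mono f" "surj f" and \<phi>: "\<phi> \<in> central" "\<phi> \<in> PL" and e: "\<And>x. \<phi> (cantor x) = cantor (f x)"
    using assms by (auto simp: inflates_def)
  note bij = inflates_bij[OF assms]
  have ff: "f (finv f x) = x" "\<phi> (finv \<phi> x) = x" for x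
    using bij by (metis bij_inv_eq_iff)+
  have "\<exists>m c. \<forall>y\<in>gap x. finv \<phi> y = m * y + c" for x
  proof -
    obtain m c where 1: "\<forall>y\<in>gap (finv f x). \<phi> y = m * y + c" using assms unfolding inflates_def by blast
    have 2: "y = m * finv \<phi> y + c" if "y \<in> gap x" for y
    proof -
      have "finv \<phi> y \<in> gap (finv f x)" using inflates_gap[OF assms, of "finv \<phi> y" "finv f x"] that ff by simp
      then show ?thesis using 1 ff by metis
    qed
    show ?thesis
    proof (cases "m = 0")
      case True
      \<comment> \<open>the gap is a single point\<close>
      then have "finv \<phi> y = 0 * y + finv \<phi> c" if "y \<in> gap x" for y using 2[OF that] by simp
      then show ?thesis by blast
    next
      case False
      then have "finv \<phi> y = (1 / m) * y + (- c / m)" if "y \<in> gap x" for y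
        using 2[OF that] by (simp add: field_simps)
      then show ?thesis by blast
    qed
  qed
  moreover have "finv \<phi> (cantor x) = cantor (finv f x)" for x
    using e[of "finv f x"] ff(1)[of x] bij(2) by (metis bij_inv_eq_iff)
  ultimately show ?thesis
    using strict_mono_surj_inv[OF f] central_inverse[OF \<phi>(1)] PL_inverse[OF \<phi>(2)]
    unfolding inflates_def by blast
qed

text \<open>Each gap is mapped to itself, so its end points are fixed, and an affine map with two fixed points is
  the identity.\<close>

lemma inflates_id_unique:
  assumes "inflates id \<phi>" shows "\<phi> = id"
proof
  fix y
  have c: "\<phi> \<in> unit_homeos" using assms central_unit_homeos by (simp add: inflates_def)
  note bij = inflates_bij(2)[OF assms]
  have g: "\<phi> v \<in> gap x \<longleftrightarrow> v \<in> gap x" for v x using inflates_gap[OF assms] by simp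
  then have g': "finv \<phi> v \<in> gap x \<longleftrightarrow> v \<in> gap x" for v x using bij by (metis bij_inv_eq_iff)
  have mono: "v \<le> w \<longleftrightarrow> \<phi> v \<le> \<phi> w" for v w using unit_homeos_less_iff[OF c] by (meson not_le)
  have ff: "\<phi> (finv \<phi> v) = v" for v using bij by (metis bij_inv_eq_iff)
  show "\<phi> y = id y"
  proof (cases "0 < y \<and> y < 1")
    case False
    then show ?thesis using unit_homeos_outside[OF c, of y] by auto
  next
    case True
    then obtain x where y: "y \<in> gap x" using gaps_cover by blast
    define p where "p = Sup (cantor ` {..<x})"
    define q where "q = Inf (cantor ` {x<..})"
    have le_p: "cantor v \<le> p" if "v < x" for v
      unfolding p_def using that y by (intro cSup_upper bdd_aboveI[of _ y]) (auto simp: gap_def)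
    have p_le: "p \<le> v" if "v \<in> gap x" for v
      unfolding p_def using that by (intro cSup_least) (auto simp: gap_def)
    have q_le: "q \<le> cantor v" if "x < v" for v
      unfolding q_def using that y by (intro cInf_lower bdd_belowI[of _ y]) (auto simp: gap_def)
    have le_q: "v \<le> q" if "v \<in> gap x" for v
      unfolding q_def using that by (intro cInf_greatest) (auto simp: gap_def)
    have "p \<le> q" using p_le[OF y] le_q[OF y] by linarith
    have pg: "p \<in> gap x" using le_p \<open>p \<le> q\<close> q_le by (force simp: gap_def)
    have qg: "q \<in> gap x" using le_p \<open>p \<le> q\<close> q_le by (force simp: gap_def)
    have "p \<le> \<phi> p" "p \<le> finv \<phi> p" using pg g g' p_le by blast+
    then have p: "\<phi> p = p" using mono[of p "finv \<phi> p"] ff by simp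
    have "\<phi> q \<le> q" "finv \<phi> q \<le> q" using qg g g' le_q by blast+
    then have q: "\<phi> q = q" using mono[of "finv \<phi> q" q] ff by simp
    obtain m c where mc: "\<forall>y\<in>gap x. \<phi> y = m * y + c" using assms unfolding inflates_def by blast
    show ?thesis
    proof (cases "p = q")
      case True
      then show ?thesis using p p_le[OF y] le_q[OF y] by simp
    next
      case False
      have "m * p + c = p" "m * q + c = q" using mc pg qg p q by auto
      then have "(m - 1) * (p - q) = 0" by (simp add: algebra_simps)
      then have "m = 1" using False by simp
      then show ?thesis using \<open>m * p + c = p\<close> mc y by simp
    qed
  qed
qed

lemma inflates_unique:
  assumes "inflates f \<phi>" "inflates f \<psi>" shows "\<phi> = \<psi>"
proof -
  have "finv f \<circ> f = id" using inflates_bij(1)[OF assms(1)] by (simp add: bij_def)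
  then have "inflates id (finv \<psi> \<circ> \<phi>)"
    using inflates_compose[OF inflates_inverse[OF assms(2)] assms(1)] by simp
  then have "finv \<psi> \<circ> \<phi> = id" by (rule inflates_id_unique)
  then show ?thesis using inflates_bij(2)[OF assms(2)] by (metis bij_inv_eq_iff comp_apply ext id_apply)
qed

lemma inflates_injective:
  assumes "inflates f \<phi>" "inflates g \<phi>" shows "f = g"
  using assms strict_mono_imp_inj_on[OF cantor_strict_mono] by (auto simp: inflates_def fun_eq_iff dest: injD) (metis injD)

text \<open>The break points of \<^term>\<open>shift\<close> are limits of the values of \<^term>\<open>cantor\<close> at \<open>-1 + (1 / 2) ^ k\<close> and \<open>- (1 / 2) ^ k\<close>.\<close>

lemma break_limits:
  shows low_break_limit: "1 / N - 1 / N\<^sup>2 islimpt range cantor"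
    and high_break_limit: "1 / N islimpt range cantor"
proof -
  have e: "cantor (d - 1) = shrink (digits d) / N" if "0 \<le> d" "d < 1" for d
  proof -
    have "\<lfloor>d\<rfloor> = 0" using that by linarith
    then have "\<lfloor>d - 1\<rfloor> = - 1" by simp
    then show ?thesis using that by (simp add: cantor_def frac_def)
  qed
  have lim: "(\<lambda>k. L + C * (1 / N) ^ Suc k) \<longlonglongrightarrow> L" for L C
  proof -
    have "(\<lambda>k. L + C * (1 / N) ^ Suc k) \<longlonglongrightarrow> L + C * 0"
      using N_ge_3 by (intro tendsto_add tendsto_mult tendsto_const LIMSEQ_Suc LIMSEQ_realpow_zero) auto
    then show ?thesis by simp
  qed
  have pow: "0 \<le> (1 / 2 :: real) ^ Suc k" "(1 / 2 :: real) ^ Suc k < 1" "0 < (1 / 2 :: real) ^ Suc k" for k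
    by (simp, rule power_Suc_less_one, simp_all)
  have pos: "0 < (1 / N) ^ Suc k" for k by (intro zero_less_power) simp
  show "1 / N - 1 / N\<^sup>2 islimpt range cantor"
    unfolding islimpt_sequential
  proof (intro exI conjI allI)
    let ?s = "\<lambda>k. cantor ((1 / 2) ^ Suc k - 1)"
    have "shrink ((N - 1) * w) / N = (1 / N - 1 / N\<^sup>2) + (N - 1) / N\<^sup>2 * w" for w
      by (simp add: shrink_def field_simps power2_eq_square)
    then have s: "?s k = (1 / N - 1 / N\<^sup>2) + (N - 1) / N\<^sup>2 * (1 / N) ^ Suc k" for k
      unfolding e[OF pow(1,2)] digits_inverse_power by (metis power_one_over divide_inverse inverse_eq_divide)
    show "?s \<longlonglongrightarrow> 1 / N - 1 / N\<^sup>2" unfolding s by (rule lim)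
    fix k
    have "0 < (N - 1) / N\<^sup>2 * (1 / N) ^ Suc k" using N_ge_3 pos by (intro mult_pos_pos divide_pos_pos) simp_all
    then have "?s k \<noteq> 1 / N - 1 / N\<^sup>2" unfolding s by linarith
    then show "?s k \<in> range cantor - {1 / N - 1 / N\<^sup>2}" by blast
  qed
  show "1 / N islimpt range cantor"
    unfolding islimpt_sequential
  proof (intro exI conjI allI)
    let ?s = "\<lambda>k. cantor (1 - (1 / 2) ^ Suc k - 1)"
    have "shrink (1 - w) / N = 1 / N + (- 1 / N\<^sup>2) * w" for w
      by (simp add: shrink_def field_simps power2_eq_square)
    moreover have "?s k = shrink (1 - 1 / N ^ Suc k) / N" for k
      using e[of "1 - (1 / 2) ^ Suc k"] pow[of k] unfolding digits_one_minus by linarith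
    ultimately have s: "?s k = 1 / N + (- 1 / N\<^sup>2) * (1 / N) ^ Suc k" for k
      by (metis power_one_over)
    show "?s \<longlonglongrightarrow> 1 / N" unfolding s by (rule lim)
    fix k
    have "(- 1 / N\<^sup>2) * (1 / N) ^ Suc k < 0" using pos by (intro mult_neg_pos divide_neg_pos) simp_all
    then have "?s k \<noteq> 1 / N" unfolding s by linarith
    then show "?s k \<in> range cantor - {1 / N}" by blast
  qed
qed

lemma strict_mono_t1: "strict_mono t1" and surj_t1: "surj t1"
proof -
  show "strict_mono t1" by (simp add: strict_mono_def t1_def)
  show "surj t1" unfolding surj_def t1_def by (metis diff_add_cancel)
qed

lemma shift_affine_on_gap: "\<exists>m c. \<forall>y\<in>gap x. shift y = m * y + c"
proof -
  let ?q = "1 / N - 1 / N\<^sup>2"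
  have b: "0 \<le> y \<and> y \<le> 1" if "y \<in> gap x" for y using gap_bounds[OF that] by simp
  consider "\<forall>y\<in>gap x. y \<le> ?q" | "\<forall>y\<in>gap x. ?q \<le> y \<and> y \<le> 1 / N" | "\<forall>y\<in>gap x. 1 / N \<le> y"
    using gap_side[OF low_break_limit, of x] gap_side[OF high_break_limit, of x] by blast
  then show ?thesis
  proof cases
    case 1
    then have "\<forall>y\<in>gap x. shift y = N * y + 0" using b shift_scale by simp
    then show ?thesis by blast
  next
    case 2
    then have "\<forall>y\<in>gap x. shift y = 1 * y + (1 - 2 / N + 1 / N\<^sup>2)" using shift_translate by simp
    then show ?thesis by blast
  next
    case 3
    then have "\<forall>y\<in>gap x. shift y = (1 / N) * y + (1 - 1 / N)"
      using b shift_shrink by (simp add: shrink_def field_simps)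
    then show ?thesis by blast
  qed
qed

lemma inflates_t1: "inflates t1 shift"
  unfolding inflates_def
  using strict_mono_t1 surj_t1 shift_central shift_PL cantor_shift shift_affine_on_gap
  by (auto simp: t1_def)

lemma strict_mono_g_gen: "strict_mono (g_gen 0)" and surj_g_gen: "surj (g_gen 0)"
proof -
  show "strict_mono (g_gen 0)" by (auto simp: strict_mono_def g_gen_def)
  show "surj (g_gen 0)"
    unfolding surj_def
  proof
    fix y :: real
    show "\<exists>x. y = g_gen 0 x"
      by (rule exI[of _ "if y < 0 then y else if y \<le> 2 then y / 2 else y - 1"]) (auto simp: g_gen_def)
  qed
qed

text \<open>The break points of \<^term>\<open>double\<close> are images of those of \<^term>\<open>shift\<close> under elements of the group generated by
  both maps, and such images are again limits of values of \<^term>\<open>cantor\<close>.\<close>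

lemma double_affine_on_gap: "\<exists>m c. \<forall>y\<in>gap x. double y = m * y + c"
proof -
  let ?q = "1 / N - 1 / N\<^sup>2"
  have cont: "isCont \<phi> y" "inj \<phi>" if "\<phi> \<in> PL" for \<phi> y
    using strict_mono_surj_isCont[OF PL_strict_mono[OF that] PL_surj[OF that]] PL_bij[OF that]
    by (auto simp: bij_def)
  note shift_limit = limit_image[OF _ cont(2)[OF shift_PL] cont(1)[OF shift_PL] cantor_shift[symmetric]]
  have bij: "bij double" using PL_bij[OF double_PL] .
  have gbij: "bij (g_gen 0)" using strict_mono_surj_bij[OF strict_mono_g_gen surj_g_gen] .
  have inv_cantor: "finv double (cantor v) = cantor (finv (g_gen 0) v)" for v
    using cantor_double[of "finv (g_gen 0) v"] bij gbij by (metis bij_inv_eq_iff)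
  note inv_limit = limit_image[OF _ cont(2)[OF PL_inverse[OF double_PL]] cont(1)[OF PL_inverse[OF double_PL]] inv_cantor]
  have sq: "shift ?q = 1 - 1 / N" using N_ineqs by (subst shift_scale) (linarith, simp, rule N_mult_break)
  \<comment> \<open>The three break points are \<open>shift b\<close>, \<open>double\<^sup>-\<^sup>1 (shift (shift b))\<close> and \<open>shift c\<close>, where \<open>b < c\<close> are the
    break points of \<^term>\<open>shift\<close> inside the unit interval.\<close>
  have l1: "1 - 1 / N islimpt range cantor" using shift_limit[OF low_break_limit] sq by simp
  have l3: "shrink (1 / N) islimpt range cantor"
    using shift_limit[OF high_break_limit] N_ineqs by (subst (asm) shift_shrink) auto
  have "double (shrink ?q) = shift (1 - 1 / N)"
    using N_ineqs by (simp only: double_shrink sq, intro shift_shrink[symmetric]) linarith+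
  then have "shrink ?q = finv double (shift (1 - 1 / N))" using bij by (metis bij_inv_eq_iff)
  then have l2: "shrink ?q islimpt range cantor" using inv_limit[OF shift_limit[OF l1]] by simp
  have z: "y = shrink (N * y - (N - 1))" for y by (simp add: shrink_inverse)
  have le: "shrink a \<le> y \<longleftrightarrow> a \<le> N * y - (N - 1)" "y \<le> shrink a \<longleftrightarrow> N * y - (N - 1) \<le> a" for a y
    by (auto simp: shrink_def field_simps)
  have b: "0 < y \<and> y < 1" if "y \<in> gap x" for y using gap_bounds[OF that] .
  have b1: "N * y - (N - 1) \<le> 1" if "y \<in> gap x" for y using b[OF that] by (simp add: algebra_simps)
  have b0: "0 \<le> N * y - (N - 1)" if "1 - 1 / N \<le> y" for y using that by (simp add: field_simps)
  consider "\<forall>y\<in>gap x. y \<le> 1 - 1 / N" | "\<forall>y\<in>gap x. 1 - 1 / N \<le> y \<and> y \<le> shrink ?q"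
    | "\<forall>y\<in>gap x. shrink ?q \<le> y \<and> y \<le> shrink (1 / N)" | "\<forall>y\<in>gap x. shrink (1 / N) \<le> y"
    using gap_side[OF l1, of x] gap_side[OF l2, of x] gap_side[OF l3, of x] by blast
  then show ?thesis
  proof cases
    case 1
    then have "\<forall>y\<in>gap x. double y = 1 * y + 0" by (simp add: double_below)
    then show ?thesis by blast
  next
    case 2
    have "\<forall>y\<in>gap x. double y = N * y + (1 - N + (1 - 1 / N))"
    proof
      fix y assume "y \<in> gap x"
      then have "0 \<le> N * y - (N - 1)" "N * y - (N - 1) \<le> ?q" using 2 b0 le by auto
      then have "double y = shrink (N * (N * y - (N - 1)))" by (simp add: double_def shift_scale)
      then show "double y = N * y + (1 - N + (1 - 1 / N))" by (simp add: shrink_def field_simps)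
    qed
    then show ?thesis by blast
  next
    case 3
    have "\<forall>y\<in>gap x. double y = 1 * y + (1 - 2 / N + 1 / N\<^sup>2) / N"
    proof
      fix y assume "y \<in> gap x"
      then have "?q \<le> N * y - (N - 1)" "N * y - (N - 1) \<le> 1 / N" using 3 le by auto
      then have "double y = shrink (N * y - (N - 1) + (1 - 2 / N + 1 / N\<^sup>2))" by (simp add: double_def shift_translate)
      also have "\<dots> = shrink (N * y - (N - 1)) + (1 - 2 / N + 1 / N\<^sup>2) / N"
        by (simp add: shrink_def diff_divide_distrib add_divide_distrib)
      finally show "double y = 1 * y + (1 - 2 / N + 1 / N\<^sup>2) / N" by (simp add: shrink_inverse)
    qed
    then show ?thesis by blast
  next
    case 4
    have "\<forall>y\<in>gap x. double y = (1 / N) * y + (1 - 1 / N)"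
    proof
      fix y assume y: "y \<in> gap x"
      then have "1 / N \<le> N * y - (N - 1)" "N * y - (N - 1) \<le> 1" using 4 b1 le by auto
      then have "double y = shrink (shrink (N * y - (N - 1)))" by (simp add: double_def shift_shrink)
      then show "double y = (1 / N) * y + (1 - 1 / N)" by (simp only: shrink_inverse) (simp add: shrink_def field_simps)
    qed
    then show ?thesis by blast
  qed
qed

lemma inflates_g_gen_0: "inflates (g_gen 0) double"
  unfolding inflates_def
  using strict_mono_g_gen surj_g_gen double_central double_PL cantor_double double_affine_on_gap
  by auto

lemma inflates_translation: "\<exists>\<phi>. inflates (\<lambda>x. x + of_int i) \<phi>"
proof (induction i rule: int_induct[where k = 0])
  case base
  show ?case using inflates_id by (auto simp: id_def)
next
  case (step1 i)
  then obtain \<phi> where "inflates (\<lambda>x. x + of_int i) \<phi>" by blast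
  from inflates_compose[OF inflates_t1 this] show ?case
    by (auto simp: comp_def t1_def add.assoc)
next
  case (step2 i)
  then obtain \<phi> where *: "inflates (\<lambda>x. x + of_int i) \<phi>" by blast
  have "finv t1 y = y - 1" for y
    using inflates_bij(1)[OF inflates_t1] by (intro inv_f_eq) (simp_all add: bij_is_inj t1_def)
  then show ?case using inflates_compose[OF inflates_inverse[OF inflates_t1] *]
    by (auto simp: comp_def add_diff_eq)
qed

lemma inflates_g_gen: "\<exists>\<phi>. inflates (g_gen i) \<phi>"
proof -
  obtain \<phi> \<psi> where "inflates (\<lambda>x. x + of_int i) \<phi>" "inflates (\<lambda>x. x + of_int (- i)) \<psi>"
    using inflates_translation by blast
  from inflates_compose[OF this(1) inflates_compose[OF inflates_g_gen_0 this(2)]]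
  have "inflates ((\<lambda>x. x + of_int i) \<circ> (g_gen 0 \<circ> (\<lambda>x. x + of_int (- i)))) (\<phi> \<circ> (double \<circ> \<psi>))" .
  moreover have "(\<lambda>x. x + of_int i) \<circ> (g_gen 0 \<circ> (\<lambda>x. x + of_int (- i))) = g_gen i"
    by (auto simp: fun_eq_iff g_gen_def)
  ultimately show ?thesis by auto
qed

section \<open>Conjugators normalize A_n\<close>

text \<open>Since \<open>n h x = \<kappa> (h (n x))\<close>, multiplication by \<open>n\<close> is conjugated to \<open>\<kappa>\<^sup>-\<^sup>1 \<circ> n\<close>, and integer translations to
  themselves. The map \<open>x \<mapsto> n\<^sup>k x + a n\<^sup>b\<close> is multiplication by \<open>n ^ (k - b)\<close>, then translation by \<open>a\<close>,
  then multiplication by \<open>n\<^sup>b\<close>.\<close>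

lemma conjugator_affine:
  assumes "\<phi> \<in> central" "\<phi> \<in> PL" "\<alpha> \<in> aff"
  obtains \<theta> where "\<theta> \<in> PL" "\<And>x. conjugator \<phi> (\<alpha> x) = \<theta> (conjugator \<phi> x)"
proof -
  let ?h = "conjugator \<phi>"
  note u = central_unit_homeos[OF assms(1)]
  have sp: "spread \<phi> \<in> PL" using spread_PL[OF u assms(2)] .
  \<comment> \<open>the conjugate of multiplication by \<open>n\<close>\<close>
  define \<sigma> where "\<sigma> = finv (spread \<phi>) \<circ> (\<lambda>x. N * x)"
  have "(\<lambda>x. N * x) \<in> PL" using affI[of 0 1] aff_subset_PL by simp
  then have \<sigma>: "\<sigma> \<in> PL" unfolding \<sigma>_def using PL_compose PL_inverse[OF sp] by blast
  have h\<sigma>: "?h (N * x) = \<sigma> (?h x)" for x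
    using conjugator_spread[OF assms(1), of x] PL_bij[OF sp] by (simp add: \<sigma>_def bij_inv_eq_iff)
  have scale: "\<exists>\<theta>\<in>PL. \<forall>x. ?h (N powi k * x) = \<theta> (?h x)" for k
  proof (induction k rule: int_induct[where k = 0])
    case base
    show ?case using PL_id by (intro bexI[of _ id]) auto
  next
    case (step1 i)
    then obtain \<theta> where \<theta>: "\<theta> \<in> PL" "\<And>x. ?h (N powi i * x) = \<theta> (?h x)" by blast
    have "?h (N powi (i + 1) * x) = (\<sigma> \<circ> \<theta>) (?h x)" for x
    proof -
      have "N powi (i + 1) * x = N * (N powi i * x)" using power_int_add[of N i 1] by simp
      then show ?thesis by (simp only: h\<sigma> \<theta>(2) comp_apply)
    qed
    then show ?case using PL_compose[OF \<sigma> \<theta>(1)] by blast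
  next
    case (step2 i)
    then obtain \<theta> where \<theta>: "\<theta> \<in> PL" "\<And>x. ?h (N powi i * x) = \<theta> (?h x)" by blast
    have "?h (N powi (i - 1) * x) = (finv \<sigma> \<circ> \<theta>) (?h x)" for x
    proof -
      have "N * (N powi (i - 1) * x) = N powi i * x" by (simp add: power_int_diff)
      then have "\<sigma> (?h (N powi (i - 1) * x)) = \<theta> (?h x)" by (metis h\<sigma> \<theta>(2))
      then show ?thesis using PL_bij[OF \<sigma>] by (simp add: bij_inv_eq_iff)
    qed
    then show ?case using PL_compose[OF PL_inverse[OF \<sigma>] \<theta>(1)] by blast
  qed
  obtain k c where kc: "\<alpha> = (\<lambda>x. N powi k * x + c)" "c \<in> Z" using assms(3) by (rule affE)
  obtain a b where ab: "c = of_int a * N powi b" using kc(2) by (rule Z_cases)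
  obtain \<theta>1 where 1: "\<theta>1 \<in> PL" "\<And>x. ?h (N powi b * x) = \<theta>1 (?h x)" using scale by blast
  obtain \<theta>2 where 2: "\<theta>2 \<in> PL" "\<And>x. ?h (N powi (k - b) * x) = \<theta>2 (?h x)" using scale by blast
  have t: "(\<lambda>x. x + of_int a) \<in> PL" by (rule aff_subset_PL[OF aff_translation]) simp
  have "?h (\<alpha> x) = (\<theta>1 \<circ> ((\<lambda>x. x + of_int a) \<circ> \<theta>2)) (?h x)" for x
  proof -
    have "\<alpha> x = N powi b * (N powi (k - b) * x + of_int a)"
      unfolding kc(1) ab by (simp add: power_int_diff field_simps)
    then show ?thesis using 1(2) 2(2) conjugator_translate[OF u] by simp
  qed
  then show ?thesis using that PL_compose[OF 1(1) PL_compose[OF t 2(1)]] by blast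
qed

lemma conjugator_Z:
  assumes "\<phi> \<in> central" "\<phi> \<in> PL" "x \<in> Z" shows "conjugator \<phi> x \<in> Z"
proof -
  obtain \<theta> where \<theta>: "\<theta> \<in> PL" "\<And>y. conjugator \<phi> (y + x) = \<theta> (conjugator \<phi> y)"
    using conjugator_affine[OF assms(1,2) aff_translation[OF assms(3)]] by blast
  have "conjugator \<phi> 0 = 0" using conjugator_of_int[OF central_unit_homeos[OF assms(1)], of 0] by simp
  then have "conjugator \<phi> x = \<theta> 0" using \<theta>(2)[of 0] by simp
  then show ?thesis using PL_Z_iff[OF \<theta>(1), of 0] by simp
qed

text \<open>Locally \<open>f\<close> is affine on each side, so its conjugate agrees there with the conjugate of an affine map.
  New breaks can only occur at images of \<open>\<int>[1/n]\<close>, which is preserved.\<close>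

lemma conjugator_normalizes:
  assumes "\<phi> \<in> central" "\<phi> \<in> PL" "f \<in> PL"
  shows "conjugator \<phi> \<circ> f \<circ> finv (conjugator \<phi>) \<in> PL"
proof (rule PL_glue)
  let ?h = "conjugator \<phi>"
  note h = conjugator_strict_mono[OF assms(1)] conjugator_surj[OF assms(1)]
  note hi = strict_mono_surj_inv[OF h]
  note f = PL_strict_mono[OF assms(3)] PL_surj[OF assms(3)]
  show "strict_mono (?h \<circ> f \<circ> finv ?h)" "surj (?h \<circ> f \<circ> finv ?h)"
    using strict_mono_surj_compose[OF strict_mono_surj_compose[OF h f] hi] by blast+
  fix y
  obtain \<alpha> \<beta> where g: "\<alpha> \<in> aff" "\<beta> \<in> aff" "germ f (finv ?h y) \<alpha> \<beta>" using assms(3) by (rule PL_germE)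
  have "\<forall>\<alpha>\<in>aff. \<exists>\<theta>. \<theta> \<in> PL \<and> (\<forall>x. ?h (\<alpha> x) = \<theta> (?h x))"
    using conjugator_affine[OF assms(1,2)] by metis
  then obtain T where T: "\<And>\<alpha>. \<alpha> \<in> aff \<Longrightarrow> T \<alpha> \<in> PL" "\<And>\<alpha> x. \<alpha> \<in> aff \<Longrightarrow> ?h (\<alpha> x) = T \<alpha> (?h x)" by metis
  have hh: "?h (finv ?h z) = z" for z using h(2) by (rule surj_f_inv_f)
  have "\<forall>\<^sub>F z in at_left y. f (finv ?h z) = \<alpha> (finv ?h z)"
    using g(3) strict_mono_surj_at_left[OF hi, of y] unfolding germ_def filterlim_iff by blast
  then have l: "\<forall>\<^sub>F z in at_left y. (?h \<circ> f \<circ> finv ?h) z = T \<alpha> z"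
    by eventually_elim (simp add: T(2)[OF g(1)] hh)
  have "\<forall>\<^sub>F z in at_right y. f (finv ?h z) = \<beta> (finv ?h z)"
    using g(3) strict_mono_surj_at_right[OF hi, of y] unfolding germ_def filterlim_iff by blast
  then have r: "\<forall>\<^sub>F z in at_right y. (?h \<circ> f \<circ> finv ?h) z = T \<beta> z"
    by eventually_elim (simp add: T(2)[OF g(2)] hh)
  have "\<alpha> = \<beta>" if "y \<notin> Z"
  proof -
    have "finv ?h y \<notin> Z" using conjugator_Z[OF assms(1,2), of "finv ?h y"] hh that by auto
    then show ?thesis using g(3) by (simp add: germ_def)
  qed
  then show "\<exists>\<alpha>\<in>PL. \<exists>\<beta>\<in>PL. germ (?h \<circ> f \<circ> finv ?h) y \<alpha> \<beta>"
    using l r T(1) g(1,2) unfolding germ_def by blast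
qed

lemma conj_by_PL: "f \<in> PL \<Longrightarrow> conj_by n h f = h \<circ> f \<circ> finv h"
  by (simp add: conj_by_def carrier_A_group)

lemma conj_by_compose:
  assumes "bij h" "bij k" "\<And>f. f \<in> PL \<Longrightarrow> k \<circ> f \<circ> finv k \<in> PL"
  shows "conj_by n (h \<circ> k) = compose PL (conj_by n h) (conj_by n k)"
proof
  fix f
  show "conj_by n (h \<circ> k) f = compose PL (conj_by n h) (conj_by n k) f"
  proof (cases "f \<in> PL")
    case True
    have "finv (h \<circ> k) = finv k \<circ> finv h" using assms(1,2) by (rule o_inv_distrib)
    then show ?thesis using True assms(3)[OF True] by (simp add: compose_def conj_by_PL comp_assoc)
  qed (simp add: compose_def conj_by_def carrier_A_group)
qed

lemma conj_by_id: "conj_by n id = (\<lambda>f\<in>PL. f)"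
  by (auto simp: conj_by_def carrier_A_group)

lemma conj_by_auto:
  assumes "\<phi> \<in> central" "\<phi> \<in> PL"
  shows "conj_by n (conjugator \<phi>) \<in> carrier (AutoGroup (A_group n))"
proof -
  let ?h = "conjugator \<phi>"
  note bij = conjugator_bij[OF assms(1)]
  note inv = central_inverse[OF assms(1)] PL_inverse[OF assms(2)]
  have maps: "conj_by n ?h f \<in> PL" if "f \<in> PL" for f
    using conjugator_normalizes[OF assms that] that by (simp add: conj_by_PL)
  have maps': "conj_by n (finv ?h) f \<in> PL" if "f \<in> PL" for f
    using conjugator_normalizes[OF inv that] that
    unfolding conjugator_inverse[OF assms(1)] by (simp add: conj_by_PL)
  have c: "?h \<circ> finv ?h = id" "finv ?h \<circ> ?h = id" "finv (finv ?h) = ?h"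
    using bij by (simp_all add: bij_def surj_iff inj_iff inv_inv_eq[OF bij])
  have "bij_betw (conj_by n ?h) PL PL"
  proof (rule bij_betw_byWitness[where f' = "conj_by n (finv ?h)"])
    have eqs: "finv ?h \<circ> (?h \<circ> f \<circ> finv ?h) \<circ> ?h = f" "?h \<circ> (finv ?h \<circ> f \<circ> ?h) \<circ> finv ?h = f" for f
      using c(1,2) by (auto simp: fun_eq_iff)
    show "\<forall>f\<in>PL. conj_by n (finv ?h) (conj_by n ?h f) = f"
      using maps eqs by (simp add: conj_by_PL c(3))
    show "\<forall>f\<in>PL. conj_by n ?h (conj_by n (finv ?h) f) = f"
      using maps' eqs by (simp add: conj_by_PL c(3))
  qed (use maps maps' in auto)
  moreover have "conj_by n ?h \<in> extensional PL" by (simp add: conj_by_def carrier_A_group)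
  moreover have "conj_by n ?h \<in> hom (A_group n) (A_group n)"
  proof (rule homI)
    fix f g assume "f \<in> carrier (A_group n)" "g \<in> carrier (A_group n)"
    then have fg: "f \<in> PL" "g \<in> PL" by (simp_all add: carrier_A_group)
    have "?h \<circ> (g \<circ> f) \<circ> finv ?h = (?h \<circ> g \<circ> finv ?h) \<circ> (?h \<circ> f \<circ> finv ?h)"
      using c(2) by (auto simp: fun_eq_iff)
    then show "conj_by n ?h (f \<otimes>\<^bsub>A_group n\<^esub> g) = conj_by n ?h f \<otimes>\<^bsub>A_group n\<^esub> conj_by n ?h g"
      using fg PL_compose[OF fg(2,1)] by (simp add: conj_by_PL)
  qed (use maps in \<open>simp add: carrier_A_group\<close>)
  ultimately show ?thesis by (simp add: AutoGroup_def auto_def Bij_def carrier_A_group)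
qed

text \<open>For \<open>p\<close> in \<open>\<int>[1/n]\<close> some element of \<open>A\<^sub>n\<close> has fixed-point set \<open>(-\<infinity>, p]\<close>. Comparing the conjugates shows that
  \<open>k\<^sup>-\<^sup>1 \<circ> h\<close> preserves all these rays, hence is the identity by density.\<close>

lemma conj_by_inject:
  assumes "bij h" "bij k" "conj_by n h = conj_by n k" shows "h = k"
proof
  fix x
  have kk: "k (finv k y) = y" "finv h (h y) = y" for y
    using assms(1,2) by (simp_all add: bij_is_surj surj_f_inv_f bij_is_inj)
  define u where "u = finv k (h x)"
  have "u \<le> p \<longleftrightarrow> x \<le> p" if "p \<in> Z" for p
  proof -
    \<comment> \<open>slope \<open>n\<close> about the fixed point \<open>p\<close> on the right of \<open>p\<close>\<close>
    let ?f = "\<lambda>x. if x \<le> p then x else N * x + (1 - N) * p"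
    have "(1 - N) * p \<in> Z" using that by (intro Z_mult Z_diff) auto
    then have "(\<lambda>x. N * x + (1 - N) * p) \<in> PL" using affI[of "(1 - N) * p" 1] aff_subset_PL by simp
    moreover have "(\<lambda>x. x) \<in> PL" using PL_id by (simp add: id_def)
    ultimately have f: "?f \<in> PL" using that by (intro PL_glue_at) (simp_all add: algebra_simps)
    have fix_iff: "?f y = y \<longleftrightarrow> y \<le> p" for y
    proof -
      have "N * y + (1 - N) * p - y = (N - 1) * (y - p)" by (simp add: algebra_simps)
      moreover have "0 < (N - 1) * (y - p)" if "\<not> y \<le> p" using that N_ge_2 by (intro mult_pos_pos) auto
      ultimately show ?thesis by auto
    qed
    have "conj_by n h ?f (h x) = conj_by n k ?f (h x)" using assms(3) by simp
    then have eq: "h (?f x) = k (?f u)" unfolding conj_by_PL[OF f] u_def by (simp add: kk)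
    have "?f x = x \<longleftrightarrow> h (?f x) = h x" using assms(1) by (simp add: bij_is_inj inj_eq)
    also have "\<dots> \<longleftrightarrow> k (?f u) = k u" unfolding eq by (simp add: u_def kk)
    also have "\<dots> \<longleftrightarrow> ?f u = u" using assms(2) by (simp add: bij_is_inj inj_eq)
    finally show ?thesis unfolding fix_iff by blast
  qed
  then have "\<not> u < x" "\<not> x < u" by (meson Z_dense leD less_imp_le)+
  then have "u = x" by simp
  then show "h x = k x" unfolding u_def by (metis kk(1))
qed

lemma conjugator_inject:
  assumes "\<phi> \<in> central" "\<psi> \<in> central" "conjugator \<phi> = conjugator \<psi>"
  shows "\<phi> = \<psi>"
proof -
  note u = central_unit_homeos[OF assms(1)] central_unit_homeos[OF assms(2)]
  have "spread \<phi> y = spread \<psi> y" for y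
  proof -
    obtain x where "conjugator \<phi> x = y" using conjugator_surj[OF assms(1)] by (metis surjD)
    then have "conjugator \<phi> (N * (x / N)) = y" by simp
    then show ?thesis
      using conjugator_spread[OF assms(1), of "x / N"] conjugator_spread[OF assms(2), of "x / N"] assms(3)
      by simp
  qed
  moreover have "spread \<rho> (1 + z) = 1 + \<rho> z" if "\<rho> \<in> unit_homeos" "0 \<le> z" "z \<le> 1" for \<rho> z
    using spread_on[OF that(1), of 1 "1 + z"] that n_ge_2 by simp
  ultimately have "\<phi> z = \<psi> z" if "0 \<le> z" "z \<le> 1" for z
    using that u by (metis add_left_cancel)
  then show ?thesis using unit_homeos_outside[OF u(1)] unit_homeos_outside[OF u(2)]
    by (metis ext linorder_linear)
qed

end

context n_adic_3
begin

text \<open>Linearity near 0 spreads to \<open>[0, 1]\<close> by self-similarity, \<open>h (n x) = n h x\<close> for \<open>x \<le> 1 / n\<close>.\<close>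

lemma piecewise_linear_conjugator:
  assumes "\<phi> \<in> unit_homeos" "piecewise_linear (conjugator \<phi>)"
  shows "conjugator \<phi> = id"
proof
  let ?h = "conjugator \<phi>"
  obtain B where B: "\<not> (0::real) islimpt B"
      "\<And>a b. {a<..<b} \<inter> B = {} \<Longrightarrow> \<exists>m c. \<forall>x\<in>{a<..<b}. ?h x = m * x + c"
    using assms(2) unfolding piecewise_linear_def by blast
  have "\<forall>\<^sub>F z in at_right 0. z \<notin> B"
    using B(1) by (simp add: islimpt_iff_eventually eventually_at_split)
  then obtain b where b: "0 < b" "\<And>z. 0 < z \<Longrightarrow> z < b \<Longrightarrow> z \<notin> B"
    unfolding eventually_at_right_field by blast
  then have "{0<..<b} \<inter> B = {}" by auto
  then obtain m c where mc: "\<And>x. 0 < x \<Longrightarrow> x < b \<Longrightarrow> ?h x = m * x + c" using B(2)[of 0 b] by auto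
  have scale: "?h (x / N) = ?h x / N" if "0 \<le> x" "x \<le> 1" for x
    using conjugator_scale[OF assms(1), of "x / N"] that by (simp add: field_simps)
  have c: "c = 0"
  proof -
    define x where "x = min (b / 2) 1"
    have x: "0 < x" "x < b" "x \<le> 1" using b(1) by (auto simp: x_def)
    have "x / N \<le> x / 1" using x N_ge_3 by (intro divide_left_mono) auto
    then have "x / N < b" using x by simp
    then have "m * (x / N) + c = (m * x + c) / N" using scale[of x] mc[of x] mc[of "x / N"] x by simp
    then have "(N - 1) * c = 0" by (simp add: field_simps)
    then show ?thesis using N_ge_3 by simp
  qed
  have lin: "?h x = m * x" if x: "0 < x" "x \<le> 1" for x
  proof -
    have iter: "?h (x / N ^ k) = ?h x / N ^ k" for k
    proof (induction k)
      case (Suc k)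
      have "1 \<le> N ^ k" using N_ge_3 by (intro one_le_power) simp
      then have "x / N ^ k \<le> 1" using x(2) by (simp add: divide_le_eq)
      then have "?h (x / N ^ k / N) = ?h (x / N ^ k) / N" using x by (intro scale) simp_all
      then show ?case using Suc by (simp add: field_simps)
    qed simp
    obtain k where "(1 / N) ^ k < b / x" using real_arch_pow_inv[of "b / x" "1 / N"] b(1) x N_ineqs by auto
    then have "x / N ^ k < b" using x by (simp add: power_one_over field_simps)
    then have "?h (x / N ^ k) = m * (x / N ^ k)" using mc[of "x / N ^ k"] x c by simp
    then show ?thesis using iter[of k] by (simp add: field_simps)
  qed
  have "?h 1 = 1" using conjugator_of_int[OF assms(1), of 1] by simp
  then have "m = 1" using lin[of 1] by simp
  fix x
  have "?h (frac x) = frac x"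
  proof (cases "frac x = 0")
    case True
    then show ?thesis using conjugator_of_int[OF assms(1), of 0] by (simp only: of_int_0)
  next
    case False
    then have "0 < frac x" "frac x \<le> 1" using frac_ge_0[of x] frac_lt_1[of x] by linarith+
    then show ?thesis using lin \<open>m = 1\<close> by simp
  qed
  then show "?h x = id x"
    using conjugator_translate[OF assms(1), of "frac x" "\<lfloor>x\<rfloor>"] by (simp add: frac_def)
qed

section \<open>The subgroup of exotic automorphisms\<close>

lemma Thompson_F_inflates:
  assumes "f \<in> carrier Thompson_F" shows "\<exists>\<phi>. inflates f \<phi>"
proof -
  interpret two: n_adic 2 by unfold_locales simp
  let ?S = "carrier (A_group 2) \<inter> ({t1} \<union> range g_gen)"
  have S: "\<exists>\<phi>. inflates h \<phi>" if "h \<in> ?S" for h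
    using that inflates_t1 inflates_g_gen by blast
  have "f \<in> generate (A_group 2) ?S"
    using assms by (simp add: Thompson_F_def carrier_subgroup_generated)
  then show ?thesis
  proof induction
    case one
    show ?case unfolding two.A_group_simps using inflates_id by blast
  next
    case (incl h)
    then show ?case by (rule S)
  next
    case (inv h)
    then have "inv\<^bsub>A_group 2\<^esub> h = finv h" by (intro two.inv_A_group) (simp add: two.carrier_A_group)
    then show ?case using S[OF inv] inflates_inverse by auto
  next
    case (eng h1 h2)
    then show ?case using inflates_compose by (metis two.A_group_simps(1))
  qed
qed

definition inflation :: "(real \<Rightarrow> real) \<Rightarrow> real \<Rightarrow> real" where
  "inflation f = (THE \<phi>. inflates f \<phi>)"

lemma inflation_eq: "inflates f \<phi> \<Longrightarrow> inflation f = \<phi>"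
  unfolding inflation_def using inflates_unique by blast

lemma inflates_inflation: "f \<in> carrier Thompson_F \<Longrightarrow> inflates f (inflation f)"
  using Thompson_F_inflates inflation_eq by blast

text \<open>The inverse accounts for the reversal of composition: products in \<open>F\<close> are taken from left to right, those
  of automorphisms from right to left.\<close>

definition exotic :: "(real \<Rightarrow> real) \<Rightarrow> real \<Rightarrow> real" where
  "exotic f = conjugator (finv (inflation f))"

definition exotic_auto :: "(real \<Rightarrow> real) \<Rightarrow> (real \<Rightarrow> real) \<Rightarrow> real \<Rightarrow> real" where
  "exotic_auto f = conj_by n (exotic f)"

lemma finv_inflation:
  assumes "f \<in> carrier Thompson_F"
  shows "finv (inflation f) \<in> central" "finv (inflation f) \<in> PL"
  using inflates_inverse[OF inflates_inflation[OF assms]] by (simp_all add: inflates_def)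

lemma exotic_auto_in_AutoGroup:
  "f \<in> carrier Thompson_F \<Longrightarrow> exotic_auto f \<in> carrier (AutoGroup (A_group n))"
  unfolding exotic_auto_def exotic_def using conj_by_auto finv_inflation by blast

lemma exotic_compose:
  assumes "f \<in> carrier Thompson_F" "g \<in> carrier Thompson_F"
  shows "exotic (g \<circ> f) = exotic f \<circ> exotic g"
proof -
  note i = inflates_inflation[OF assms(1)] inflates_inflation[OF assms(2)]
  have "inflation (g \<circ> f) = inflation g \<circ> inflation f"
    by (rule inflation_eq[OF inflates_compose[OF i(2,1)]])
  then have "finv (inflation (g \<circ> f)) = finv (inflation f) \<circ> finv (inflation g)"
    using inflates_bij(2)[OF i(1)] inflates_bij(2)[OF i(2)] by (simp add: o_inv_distrib)
  then show ?thesis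
    using conjugator_compose finv_inflation assms by (simp add: exotic_def)
qed

lemma Thompson_F_mult: "f \<otimes>\<^bsub>Thompson_F\<^esub> g = g \<circ> f"
  by (simp add: Thompson_F_def subgroup_generated_def A_group_def)

lemma exotic_auto_hom: "exotic_auto \<in> hom Thompson_F (AutoGroup (A_group n))"
proof (rule homI)
  fix f g assume fg: "f \<in> carrier Thompson_F" "g \<in> carrier Thompson_F"
  have "exotic_auto (f \<otimes>\<^bsub>Thompson_F\<^esub> g) = conj_by n (exotic f \<circ> exotic g)"
    by (simp add: exotic_auto_def Thompson_F_mult exotic_compose[OF fg])
  also have "\<dots> = compose PL (exotic_auto f) (exotic_auto g)"
    unfolding exotic_auto_def exotic_def
    using finv_inflation[OF fg(1)] finv_inflation[OF fg(2)]
    by (intro conj_by_compose conjugator_bij conjugator_normalizes)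
  also have "\<dots> = exotic_auto f \<otimes>\<^bsub>AutoGroup (A_group n)\<^esub> exotic_auto g"
    using exotic_auto_in_AutoGroup[OF fg(1)] exotic_auto_in_AutoGroup[OF fg(2)]
    by (simp add: AutoGroup_def BijGroup_def auto_def carrier_A_group)
  finally show "exotic_auto (f \<otimes>\<^bsub>Thompson_F\<^esub> g) = exotic_auto f \<otimes>\<^bsub>AutoGroup (A_group n)\<^esub> exotic_auto g" .
qed (rule exotic_auto_in_AutoGroup)

lemma exotic_auto_inj: "inj_on exotic_auto (carrier Thompson_F)"
proof (rule inj_onI)
  fix f g assume fg: "f \<in> carrier Thompson_F" "g \<in> carrier Thompson_F" and eq: "exotic_auto f = exotic_auto g"
  note c = finv_inflation(1)[OF fg(1)] finv_inflation(1)[OF fg(2)]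
  have "exotic f = exotic g"
    using eq conjugator_bij[OF c(1)] conjugator_bij[OF c(2)]
    unfolding exotic_auto_def exotic_def by (intro conj_by_inject)
  then have "finv (inflation f) = finv (inflation g)"
    unfolding exotic_def by (rule conjugator_inject[OF c])
  then have "inflates (finv f) (finv (inflation g))" "inflates (finv g) (finv (inflation g))"
    using inflates_inverse[OF inflates_inflation[OF fg(1)]] inflates_inverse[OF inflates_inflation[OF fg(2)]] by simp_all
  then have "finv f = finv g" by (rule inflates_injective)
  then show "f = g"
    using inflates_bij(1)[OF inflates_inflation[OF fg(1)]] inflates_bij(1)[OF inflates_inflation[OF fg(2)]]
    by (metis inv_inv_eq)
qed

lemma exotic_auto_PL:
  assumes "f \<in> carrier Thompson_F" "exotic_auto f \<in> Aut_PL n"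
  shows "exotic_auto f = \<one>\<^bsub>AutoGroup (A_group n)\<^esub>"
proof -
  obtain h where h: "homeo_R h" "piecewise_linear h" "exotic_auto f = conj_by n h"
    using assms(2) by (auto simp: Aut_PL_def)
  have "bij h" using h(1) unfolding homeo_R_def homeomorphism_def by (metis UNIV_I bijI')
  then have "exotic f = h"
    using h(3) conjugator_bij[OF finv_inflation(1)[OF assms(1)]]
    unfolding exotic_auto_def exotic_def by (intro conj_by_inject)
  then have "exotic f = id"
    using h(2) piecewise_linear_conjugator[OF central_unit_homeos[OF finv_inflation(1)[OF assms(1)]]]
    unfolding exotic_def by simp
  then show ?thesis
    by (simp add: exotic_auto_def conj_by_id AutoGroup_def BijGroup_def carrier_A_group)
qed

lemma one_in_Aut_PL: "\<one>\<^bsub>AutoGroup (A_group n)\<^esub> \<in> Aut_PL n"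
proof -
  have "\<one>\<^bsub>AutoGroup (A_group n)\<^esub> = conj_by n id"
    by (simp add: conj_by_id AutoGroup_def BijGroup_def carrier_A_group)
  moreover have "homeo_R id" by (rule strict_mono_surj_homeo_R) (simp_all add: strict_mono_def)
  moreover have "piecewise_linear id"
  proof -
    have "\<forall>a b. {a<..<b} \<inter> {} = {} \<longrightarrow> (\<exists>m c. \<forall>x\<in>{a<..<b}. id x = m * x + (c::real))"
      by (intro allI impI, rule exI[of _ 1], rule exI[of _ 0]) simp
    then show ?thesis unfolding piecewise_linear_def by (auto intro: exI[of _ "{}"])
  qed
  moreover have "\<one>\<^bsub>AutoGroup (A_group n)\<^esub> \<in> carrier (AutoGroup (A_group n))"
    using group.AutoGroup[OF group_A_group] by (simp add: group.is_monoid monoid.one_closed)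
  ultimately show ?thesis unfolding Aut_PL_def by blast
qed

end

theorem theorem6p1p5:
  fixes n :: int
  assumes "n \<ge> 3"
  shows "\<exists>Fhat. subgroup Fhat (AutoGroup (A_group n)) \<and>
           (AutoGroup (A_group n))\<lparr>carrier := Fhat\<rparr> \<cong> Thompson_F \<and>
           Fhat \<inter> Aut_PL n = {\<one>\<^bsub>AutoGroup (A_group n)\<^esub>}"
proof -
  interpret n_adic_3 n using assms by unfold_locales simp_all
  interpret two: n_adic 2 by unfold_locales simp
  let ?A = "AutoGroup (A_group n)"
  let ?F = "exotic_auto ` carrier Thompson_F"
  interpret T: group Thompson_F
    unfolding Thompson_F_def by (rule group.group_subgroup_generated[OF two.group_A_group])
  interpret A: group ?A by (rule group.AutoGroup[OF group_A_group])
  interpret hom: group_hom Thompson_F ?A exotic_auto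
    using exotic_auto_hom by (simp add: group_hom_def group_hom_axioms_def T.is_group A.is_group)
  have sub: "subgroup ?F ?A" by (rule hom.img_is_subgroup)
  have "exotic_auto \<in> iso Thompson_F (?A\<lparr>carrier := ?F\<rparr>)"
    using exotic_auto_hom exotic_auto_inj by (auto simp: iso_def hom_def bij_betw_def)
  then have "Thompson_F \<cong> ?A\<lparr>carrier := ?F\<rparr>" unfolding is_iso_def by blast
  then have "?A\<lparr>carrier := ?F\<rparr> \<cong> Thompson_F" by (rule T.iso_sym)
  moreover have "?F \<inter> Aut_PL n = {\<one>\<^bsub>?A\<^esub>}"
    using exotic_auto_PL one_in_Aut_PL subgroup.one_closed[OF sub] by auto
  ultimately show ?thesis using sub by blast
qed

end
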